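(* Let $I=[-1,1]$ and let $s>0$ be a real number. Let $E:H^s(I)\to H^s(\mathbb R)$ be a linear continuous extension operator (so $E f|_I=f$) for which there is a constant $C$ such that $\|Ef\|_{L^2(\mathbb R)}\le C\|f\|_{L^2(I)}$ and $\|Ef\|_{H^s(\mathbb R)}\le C\|f\|_{H^s(I)}$ for all $f\in H^s(I)$. Then there is a constant $K>0$, depending only on $s$ and on the extension operator $E$, such that for every real $c>0$, every $f\in H^s(I)$ and every integer $N\ge 1$, $$\| f-S_N f\|_{L^2(I)}\leq K(1+c^2)^{-s/2}\,\|f\|_{H^s(I)}+K\sqrt{\lambda_N(c)}\,\|f\|_{L^2(I)}.$$ Moreover, the constant $K$ can be taken equal to $1$ when $f$ belongs to the space $H^s_0(I)$.
   Context: For $c>0$, the prolate spheroidal wave functions (PSWFs) $(\psi_{n,c})_{n\ge 0}$ form the orthonormal basis of $L^2([-1,1])$ consisting of eigenfunctions of the compact integral operator $\mathcal Q_c(f)(x)=\int_{-1}^1\frac{\sin c(x-y)}{\pi(x-y)}f(y)\,dy$ on $L^2([-1,1])$. Its eigenvalues are $\lambda_n(c)$, with $\mathcal Q_c\psi_{n,c}=\lambda_n(c)\psi_{n,c}$, arranged in decreasing order $1>\lambda_0(c)>\lambda_1(c)>\cdots>\lambda_n(c)>\cdots>0$. For $f\in L^2(I)$, the $N$-th partial sum of its PSWF expansion is $S_Nf=\sum_{n<N}\langle f,\psi_{n,c}\rangle\psi_{n,c}$, where $\langle f,g\rangle=\int_{-1}^1 f\overline g$. The norm on $H^s(\mathbb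 R)$ is $\|F\|_{H^s(\mathbb R)}^2=\frac1{2\pi}\int_{\mathbb R}(1+|\xi|^2)^s|\widehat F(\xi)|^2\,d\xi$ with $\widehat F(\xi)=\int_{\mathbb R}F(x)e^{-ix\xi}\,dx$. $H^s(I)$ is the usual Sobolev space on $I$ (restrictions to $I$ of functions of $H^s(\mathbb R)$) with any fixed standard norm. $H^s_0(I)$ is the subspace of those $f\in H^s(I)$ whose extension by $0$ outside $I$ belongs to $H^s(\mathbb R)$; for such $f$, in the last assertion, $\|f\|_{H^s(I)}$ denotes the $H^s(\mathbb R)$ norm of the extension of $f$ by $0$. *)

theory Defs
  imports "HOL-Analysis.Analysis"
begin

text \<open>
  Elements of $L^2$ are represented by Borel functions, and equality of elements by equality almost
  everywhere; for functions on $I = [-1,1]$ the values outside $I$ are irrelevant.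
\<close>

definition L2 :: "real measure \<Rightarrow> (real \<Rightarrow> complex) set" where
  "L2 M = {f \<in> borel_measurable M. integrable M (\<lambda>x. (cmod (f x))\<^sup>2)}"

definition L2_norm :: "real measure \<Rightarrow> (real \<Rightarrow> complex) \<Rightarrow> real" where
  "L2_norm M f = sqrt (LINT x|M. (cmod (f x))\<^sup>2)"

definition L2_inner :: "real measure \<Rightarrow> (real \<Rightarrow> complex) \<Rightarrow> (real \<Rightarrow> complex) \<Rightarrow> complex" where
  "L2_inner M f g = (LINT x|M. f x * cnj (g x))"

abbreviation leb_I :: "real measure" where
  "leb_I \<equiv> restrict_space lborel {-1..1}"

definition truncated_fourier :: "(real \<Rightarrow> complex) \<Rightarrow> real \<Rightarrow> real \<Rightarrow> complex" where
  "truncated_fourier F R \<xi> = (LINT x:{-R..R}|lborel. F x * exp (- \<i> * of_real (x * \<xi>)))"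

text \<open>
  The integral defining the Fourier transform of a function in $L^2$ is the limit in $L^2$ of the
  integrals over $[-R,R]$. A function in $L^2$ has at most one such transform up to null sets.
\<close>

definition has_fourier_transform :: "(real \<Rightarrow> complex) \<Rightarrow> (real \<Rightarrow> complex) \<Rightarrow> bool" where
  "has_fourier_transform F G \<longleftrightarrow> F \<in> L2 lborel \<and> G \<in> L2 lborel \<and>
     ((\<lambda>R. \<integral>\<^sup>+ \<xi>. ennreal ((cmod (truncated_fourier F R \<xi> - G \<xi>))\<^sup>2) \<partial>lborel) \<longlongrightarrow> 0) at_top"

definition fourier :: "(real \<Rightarrow> complex) \<Rightarrow> real \<Rightarrow> complex" where
  "fourier F = (SOME G. has_fourier_transform F G)"

definition sobolev :: "real \<Rightarrow> (real \<Rightarrow> complex) set" where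
  "sobolev s = {F \<in> L2 lborel. \<exists>G. has_fourier_transform F G \<and>
     integrable lborel (\<lambda>\<xi>. (1 + \<xi>\<^sup>2) powr s * (cmod (G \<xi>))\<^sup>2)}"

definition sobolev_norm :: "real \<Rightarrow> (real \<Rightarrow> complex) \<Rightarrow> real" where
  "sobolev_norm s F =
     sqrt (1 / (2 * pi) * (LINT \<xi>|lborel. (1 + \<xi>\<^sup>2) powr s * (cmod (fourier F \<xi>))\<^sup>2))"

definition sobolev_I :: "real \<Rightarrow> (real \<Rightarrow> complex) set" where
  "sobolev_I s = {f \<in> L2 leb_I. \<exists>F \<in> sobolev s. AE x in leb_I. F x = f x}"

definition sobolev_I_quotient_norm :: "real \<Rightarrow> (real \<Rightarrow> complex) \<Rightarrow> real" where
  "sobolev_I_quotient_norm s f =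
     Inf {sobolev_norm s F | F. F \<in> sobolev s \<and> (AE x in leb_I. F x = f x)}"

text \<open>
  The norms regarded as standard on $H^s(I)$ are those equivalent to the quotient norm. The
  equivalence makes them nonnegative, and zero exactly on functions vanishing almost everywhere.
\<close>

definition standard_sobolev_I_norm :: "real \<Rightarrow> ((real \<Rightarrow> complex) \<Rightarrow> real) \<Rightarrow> bool" where
  "standard_sobolev_I_norm s nrm \<longleftrightarrow>
     (\<forall>f \<in> sobolev_I s. \<forall>g \<in> sobolev_I s. nrm (\<lambda>x. f x + g x) \<le> nrm f + nrm g) \<and>
     (\<forall>f \<in> sobolev_I s. \<forall>a. nrm (\<lambda>x. a * f x) = cmod a * nrm f) \<and>
     (\<exists>A>0. \<exists>B>0. \<forall>f \<in> sobolev_I s.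
        A * sobolev_I_quotient_norm s f \<le> nrm f \<and> nrm f \<le> B * sobolev_I_quotient_norm s f)"

definition zero_extension :: "(real \<Rightarrow> complex) \<Rightarrow> real \<Rightarrow> complex" where
  "zero_extension f x = (if x \<in> {-1..1} then f x else 0)"

definition sobolev_I_0 :: "real \<Rightarrow> (real \<Rightarrow> complex) set" where
  "sobolev_I_0 s = {f \<in> sobolev_I s. zero_extension f \<in> sobolev s}"

text \<open>
  Linearity and the $L^2$ bound imply that \<open>E\<close> respects equality almost everywhere on $I$; the
  last bound is its continuity.
\<close>

definition extension_operator ::
    "real \<Rightarrow> ((real \<Rightarrow> complex) \<Rightarrow> real) \<Rightarrow> ((real \<Rightarrow> complex) \<Rightarrow> real \<Rightarrow> complex) \<Rightarrow> bool" where
  "extension_operator s nrm E \<longleftrightarrow>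
     (\<forall>f \<in> sobolev_I s. E f \<in> sobolev s) \<and>
     (\<forall>f \<in> sobolev_I s. \<forall>g \<in> sobolev_I s.
        AE x in lborel. E (\<lambda>t. f t + g t) x = E f x + E g x) \<and>
     (\<forall>f \<in> sobolev_I s. \<forall>a. AE x in lborel. E (\<lambda>t. a * f t) x = a * E f x) \<and>
     (\<forall>f \<in> sobolev_I s. AE x in leb_I. E f x = f x) \<and>
     (\<exists>C. \<forall>f \<in> sobolev_I s.
        L2_norm lborel (E f) \<le> C * L2_norm leb_I f \<and> sobolev_norm s (E f) \<le> C * nrm f)"

text \<open>The value of the kernel on the diagonal, a null set, does not affect the integral.\<close>

definition sinc_operator :: "real \<Rightarrow> (real \<Rightarrow> complex) \<Rightarrow> real \<Rightarrow> complex" where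
  "sinc_operator c f x =
     (LINT y|leb_I. of_real (sin (c * (x - y)) / (pi * (x - y))) * f y)"

definition partial_expansion ::
    "(nat \<Rightarrow> real \<Rightarrow> complex) \<Rightarrow> nat \<Rightarrow> (real \<Rightarrow> complex) \<Rightarrow> real \<Rightarrow> complex" where
  "partial_expansion \<psi> N f x = (\<Sum>n<N. L2_inner leb_I f (\<psi> n) * \<psi> n x)"

definition orthonormal_basis_I :: "(nat \<Rightarrow> real \<Rightarrow> complex) \<Rightarrow> bool" where
  "orthonormal_basis_I \<psi> \<longleftrightarrow>
     (\<forall>n. \<psi> n \<in> L2 leb_I) \<and>
     (\<forall>m n. L2_inner leb_I (\<psi> m) (\<psi> n) = (if m = n then 1 else 0)) \<and>
     (\<forall>f \<in> L2 leb_I. (\<lambda>N. L2_norm leb_I (\<lambda>x. f x - partial_expansion \<psi> N f x)) \<longlonglongrightarrow> 0)"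

text \<open>
  The eigenvalues are simple, so \<open>c\<close> determines \<open>\<mu>\<close>, and determines each \<open>\<psi> n\<close> up to a
  unimodular factor, on which the partial expansions do not depend.
\<close>

definition pswf_system :: "real \<Rightarrow> (nat \<Rightarrow> real \<Rightarrow> complex) \<Rightarrow> (nat \<Rightarrow> real) \<Rightarrow> bool" where
  "pswf_system c \<psi> \<mu> \<longleftrightarrow>
     orthonormal_basis_I \<psi> \<and>
     (\<forall>n. AE x in leb_I. sinc_operator c (\<psi> n) x = of_real (\<mu> n) * \<psi> n x) \<and>
     \<mu> 0 < 1 \<and> (\<forall>n. \<mu> (Suc n) < \<mu> n) \<and> (\<forall>n. 0 < \<mu> n)"

end

theory Submission
  imports Defs "HOL-Probability.Characteristic_Functions"
begin

text \<open>
  Let \<open>F\<close> extend \<open>f\<close>, let \<open>D = f - S\<^sub>N f\<close>, extended by zero, and let hats denote Fourier transforms.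
  As \<open>D\<close> is orthogonal to \<open>S\<^sub>N f\<close>, Parseval gives \<open>\<parallel>D\<parallel>\<^sup>2 = \<langle>F, D\<rangle> = \<langle>F^, D^\<rangle> / 2\<pi>\<close>. On \<open>\<bar>\<xi>\<bar> > c\<close>
  the Sobolev weight of \<open>F^\<close> is at least \<open>(1 + c\<^sup>2)\<^sup>s\<close>, which yields the first term of the bound. On
  \<open>\<bar>\<xi>\<bar> \<le> c\<close> the energy of \<open>D^\<close> is \<open>2\<pi> \<langle>Q\<^sub>c D, D\<rangle> \<le> 2\<pi> \<lambda>\<^sub>N \<parallel>D\<parallel>\<^sup>2\<close>, because \<open>D\<close> is a limit of
  combinations of the \<open>\<psi>\<^sub>n\<close> with \<open>n \<ge> N\<close>; this yields the second term. Plancherel itself is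
  obtained by Gaussian regularization: the Gaussian means of \<open>\<bar>f^\<bar>\<^sup>2\<close> are averages of the
  autocorrelation of \<open>f\<close>, which is continuous at the origin.
\<close>

section \<open>Square-integrable functions\<close>

text \<open>The estimate is proved once, with constant 1, for an arbitrary extension
  \<open>F\<close> of \<open>f\<close>; its two terms carry the Sobolev norm and the L2 norm of
  \<open>F\<close>. Both assertions are instances: \<open>F = E f\<close> brings in the bounds on
  \<open>E\<close>, while the zero extension has the same L2 norm as \<open>f\<close>, so nothing is
  lost. No constant arises because the norm of \<open>D\<close> occurs on both sides and cancels,
  and the factor 2 pi of Parseval cancels against two Plancherel factors sqrt(2 pi).
  \<open>D\<close> lives on a bounded interval, so its transform is an absolutely convergent
  integral. \<open>F\<close> is merely square integrable, and its transform is an L2 limit.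
  Plancherel is therefore established for integrable functions in L2 and then carried over by
  truncation. Square integrability of the transform is not known in advance; the Gaussian weights
  are made to increase to 1 so that monotone convergence gives finiteness together with the
  value.\<close>

lemma borel_measurable_cnj [measurable (raw)]:
  "f \<in> borel_measurable M \<Longrightarrow> (\<lambda>x. cnj (f x)) \<in> borel_measurable M"
  by (rule borel_measurable_continuous_on[of cnj]) (auto intro: continuous_intros)

lemma L2I:
  "f \<in> borel_measurable M \<Longrightarrow> integrable M (\<lambda>x. (cmod (f x))\<^sup>2) \<Longrightarrow> f \<in> L2 M"
  by (simp add: L2_def)

lemma L2_measurable: "f \<in> L2 M \<Longrightarrow> f \<in> borel_measurable M"
  by (simp add: L2_def)

lemma L2_integrable_square: "f \<in> L2 M \<Longrightarrow> integrable M (\<lambda>x. (cmod (f x))\<^sup>2)"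
  by (simp add: L2_def)

lemma L2_norm_nonneg [simp]: "0 \<le> L2_norm M f"
  by (simp add: L2_norm_def)

lemma L2_norm_square: "(L2_norm M f)\<^sup>2 = (LINT x|M. (cmod (f x))\<^sup>2)"
  by (simp add: L2_norm_def)

lemma nn_integral_L2_norm:
  "f \<in> L2 M \<Longrightarrow> (\<integral>\<^sup>+x. ennreal ((cmod (f x))\<^sup>2) \<partial>M) = ennreal ((L2_norm M f)\<^sup>2)"
  unfolding L2_norm_square
  by (rule nn_integral_eq_integral) (auto simp: L2_integrable_square)

lemma L2_add:
  assumes f: "f \<in> L2 M" and g: "g \<in> L2 M" shows "(\<lambda>x. f x + g x) \<in> L2 M"
proof (rule L2I)
  note [measurable] = f[THEN L2_measurable] g[THEN L2_measurable]
  show "(\<lambda>x. f x + g x) \<in> borel_measurable M" by measurable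
  show "integrable M (\<lambda>x. (cmod (f x + g x))\<^sup>2)"
  proof (rule Bochner_Integration.integrable_bound)
    show "integrable M (\<lambda>x. 2 * (cmod (f x))\<^sup>2 + 2 * (cmod (g x))\<^sup>2)"
      using f g by (auto simp: L2_integrable_square)
    show "AE x in M. norm ((cmod (f x + g x))\<^sup>2) \<le> norm (2 * (cmod (f x))\<^sup>2 + 2 * (cmod (g x))\<^sup>2)"
    proof (rule AE_I2)
      fix x
      have "(cmod (f x + g x))\<^sup>2 \<le> (cmod (f x) + cmod (g x))\<^sup>2"
        by (intro power_mono norm_triangle_ineq) auto
      also have "\<dots> \<le> 2 * (cmod (f x))\<^sup>2 + 2 * (cmod (g x))\<^sup>2"
        using sum_squares_bound[of "cmod (f x)" "cmod (g x)"] by (simp add: power2_sum)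
      finally show "norm ((cmod (f x + g x))\<^sup>2) \<le> norm (2 * (cmod (f x))\<^sup>2 + 2 * (cmod (g x))\<^sup>2)"
        by simp
    qed
  qed measurable
qed

lemma L2_scale:
  assumes f: "f \<in> L2 M" shows "(\<lambda>x. a * f x) \<in> L2 M"
  using f by (auto simp: L2_def norm_mult power_mult_distrib)

lemma L2_norm_scale: "L2_norm M (\<lambda>x. a * f x) = cmod a * L2_norm M f"
  by (simp add: L2_norm_def norm_mult power_mult_distrib real_sqrt_mult)

lemma L2_diff:
  assumes f: "f \<in> L2 M" and g: "g \<in> L2 M" shows "(\<lambda>x. f x - g x) \<in> L2 M"
  using L2_add[OF f L2_scale[OF g, of "-1"]] by simp

lemma L2_sum:
  "(\<And>i. i \<in> A \<Longrightarrow> f i \<in> L2 M) \<Longrightarrow> (\<lambda>x. \<Sum>i\<in>A. f i x) \<in> L2 M"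
proof (induction A rule: infinite_finite_induct)
  case (insert a A)
  then show ?case using L2_add[of "f a" M "\<lambda>x. \<Sum>i\<in>A. f i x"] by simp
qed (auto simp: L2_def)

lemma L2_bounded_mult:
  assumes f: "f \<in> L2 M" and [measurable]: "g \<in> borel_measurable M" and b: "\<And>x. cmod (g x) \<le> 1"
  shows "(\<lambda>x. g x * f x) \<in> L2 M"
proof (rule L2I)
  note [measurable] = f[THEN L2_measurable]
  show "(\<lambda>x. g x * f x) \<in> borel_measurable M" by measurable
  show "integrable M (\<lambda>x. (cmod (g x * f x))\<^sup>2)"
    using L2_integrable_square[OF f]
    by (rule Bochner_Integration.integrable_bound)
       (auto simp: norm_mult power_mult_distrib power_le_one b intro!: mult_left_le_one_le AE_I2)
qed

lemma L2_mult_integrable: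
  assumes f: "f \<in> L2 M" and g: "g \<in> L2 M"
  shows "integrable M (\<lambda>x. f x * cnj (g x))"
proof -
  note [measurable] = f[THEN L2_measurable] g[THEN L2_measurable]
  show ?thesis
  proof (rule Bochner_Integration.integrable_bound)
    show "integrable M (\<lambda>x. (cmod (f x))\<^sup>2 + (cmod (g x))\<^sup>2)"
      using f g by (auto simp: L2_integrable_square)
    show "AE x in M. norm (f x * cnj (g x)) \<le> norm ((cmod (f x))\<^sup>2 + (cmod (g x))\<^sup>2)"
    proof (rule AE_I2)
      fix x
      have "0 \<le> (cmod (f x))\<^sup>2 + (cmod (g x))\<^sup>2" "0 \<le> cmod (f x) * cmod (g x)" by auto
      then show "norm (f x * cnj (g x)) \<le> norm ((cmod (f x))\<^sup>2 + (cmod (g x))\<^sup>2)"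
        using sum_squares_bound[of "cmod (f x)" "cmod (g x)"] unfolding norm_mult complex_mod_cnj
        by (simp only: real_norm_def abs_of_nonneg mult.assoc)
    qed
  qed measurable
qed

lemma L2_Cauchy_Schwarz_norm:
  assumes f: "f \<in> L2 M" and g: "g \<in> L2 M"
  shows "(LINT x|M. cmod (f x) * cmod (g x)) \<le> L2_norm M f * L2_norm M g"
proof -
  note [measurable] = f[THEN L2_measurable] g[THEN L2_measurable]
  let ?I = "LINT x|M. cmod (f x) * cmod (g x)"
  have i: "integrable M (\<lambda>x. cmod (f x) * cmod (g x))"
    using integrable_norm[OF L2_mult_integrable[OF f g]] by (simp add: norm_mult)
  have "(\<integral>\<^sup>+x. ennreal (cmod (f x)) * ennreal (cmod (g x)) \<partial>M)\<^sup>2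
      \<le> (\<integral>\<^sup>+x. (ennreal (cmod (f x)))\<^sup>2 \<partial>M) * (\<integral>\<^sup>+x. (ennreal (cmod (g x)))\<^sup>2 \<partial>M)"
    by (rule Cauchy_Schwarz_nn_integral) auto
  also have "(\<integral>\<^sup>+x. ennreal (cmod (f x)) * ennreal (cmod (g x)) \<partial>M) = ennreal ?I"
    by (subst nn_integral_eq_integral[symmetric]) (auto simp: i ennreal_mult)
  finally have "ennreal (?I\<^sup>2) \<le> ennreal ((L2_norm M f * L2_norm M g)\<^sup>2)"
    by (simp add: ennreal_power nn_integral_L2_norm f g power_mult_distrib ennreal_mult)
  then have "?I\<^sup>2 \<le> (L2_norm M f * L2_norm M g)\<^sup>2"
    by (subst (asm) ennreal_le_iff) auto
  then show ?thesis by (rule power2_le_imp_le) auto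
qed

lemma L2_Cauchy_Schwarz:
  assumes f: "f \<in> L2 M" and g: "g \<in> L2 M"
  shows "cmod (L2_inner M f g) \<le> L2_norm M f * L2_norm M g"
proof -
  have "cmod (L2_inner M f g) \<le> (LINT x|M. cmod (f x) * cmod (g x))"
    unfolding L2_inner_def using integral_norm_bound[of M "\<lambda>x. f x * cnj (g x)"] by (simp add: norm_mult)
  with L2_Cauchy_Schwarz_norm[OF f g] show ?thesis by simp
qed

text \<open>This expansion serves three purposes: the triangle inequality, the link between
  autocorrelation and translation differences, and Parseval's formula by polarization.\<close>

lemma L2_norm_add_square:
  assumes f: "f \<in> L2 M" and g: "g \<in> L2 M"
  shows "(L2_norm M (\<lambda>x. f x + g x))\<^sup>2 =
    (L2_norm M f)\<^sup>2 + 2 * Re (L2_inner M f g) + (L2_norm M g)\<^sup>2"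
proof -
  have *: "(cmod (z + w))\<^sup>2 = (cmod z)\<^sup>2 + 2 * Re (z * cnj w) + (cmod w)\<^sup>2" for z w
    unfolding cmod_power2 by (simp add: power2_eq_square algebra_simps)
  have "integrable M (\<lambda>x. Re (f x * cnj (g x)))"
    using L2_mult_integrable[OF f g] by (rule integrable_Re)
  then show ?thesis
    unfolding L2_norm_square L2_inner_def *
    using L2_mult_integrable[OF f g] f g
    by (simp add: L2_integrable_square del: times_complex.sel)
qed

lemma L2_norm_triangle:
  assumes f: "f \<in> L2 M" and g: "g \<in> L2 M"
  shows "L2_norm M (\<lambda>x. f x + g x) \<le> L2_norm M f + L2_norm M g"
proof (rule power2_le_imp_le)
  have "Re (L2_inner M f g) \<le> L2_norm M f * L2_norm M g"
    using L2_Cauchy_Schwarz[OF f g] complex_Re_le_cmod[of "L2_inner M f g"] by linarith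
  then show "(L2_norm M (\<lambda>x. f x + g x))\<^sup>2 \<le> (L2_norm M f + L2_norm M g)\<^sup>2"
    unfolding L2_norm_add_square[OF f g] by (simp add: power2_sum)
qed auto

lemma L2_norm_minus_commute: "L2_norm M (\<lambda>x. f x - g x) = L2_norm M (\<lambda>x. g x - f x)"
  by (simp add: L2_norm_def norm_minus_commute)

lemma L2_norm_diff_le:
  assumes f: "f \<in> L2 M" and g: "g \<in> L2 M"
  shows "\<bar>L2_norm M f - L2_norm M g\<bar> \<le> L2_norm M (\<lambda>x. f x - g x)"
  using L2_norm_triangle[OF L2_diff[OF f g] g] L2_norm_triangle[OF L2_diff[OF g f] f]
    L2_norm_minus_commute[of M f g] by auto

lemma L2_norm_diff_triangle:
  assumes f: "f \<in> L2 M" and g: "g \<in> L2 M" and h: "h \<in> L2 M"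
  shows "L2_norm M (\<lambda>x. f x - h x) \<le> L2_norm M (\<lambda>x. f x - g x) + L2_norm M (\<lambda>x. g x - h x)"
  using L2_norm_triangle[OF L2_diff[OF f g] L2_diff[OF g h]] by simp

lemma tendsto_L2_norm:
  assumes "\<forall>\<^sub>F i in F. f i \<in> L2 M" and g: "g \<in> L2 M"
    and "((\<lambda>i. L2_norm M (\<lambda>x. f i x - g x)) \<longlongrightarrow> 0) F"
  shows "((\<lambda>i. L2_norm M (f i)) \<longlongrightarrow> L2_norm M g) F"
proof -
  have "((\<lambda>i. L2_norm M (f i) - L2_norm M g) \<longlongrightarrow> 0) F"
    by (rule Lim_null_comparison[OF _ assms(3)])
       (use assms(1) in eventually_elim, simp add: L2_norm_diff_le g)
  then show ?thesis by (simp add: LIM_zero_iff)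
qed

lemma L2_norm_eq_0_AE:
  assumes "f \<in> L2 M" "L2_norm M f = 0" shows "AE x in M. f x = 0"
proof -
  have "(LINT x|M. (cmod (f x))\<^sup>2) = 0" using assms(2) L2_norm_square[of M f] by simp
  then have "AE x in M. (cmod (f x))\<^sup>2 = 0"
    by (subst (asm) integral_nonneg_eq_0_iff_AE) (auto simp: assms L2_integrable_square)
  then show ?thesis by eventually_elim simp
qed

text \<open>The limit itself dominates the sequence, which fits truncations in value as well as in
  domain. Then \<open>|f i - g|\<close> is at most \<open>2 |g|\<close>, whence the dominating
  function \<open>4 |g|^2\<close>.\<close>

lemma L2_dominated_convergence:
  fixes f :: "nat \<Rightarrow> real \<Rightarrow> complex"
  assumes g: "g \<in> L2 M" and [measurable]: "\<And>i. f i \<in> borel_measurable M"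
    and lim: "\<And>x. x \<in> space M \<Longrightarrow> (\<lambda>i. f i x) \<longlonglongrightarrow> g x" and bd: "\<And>i x. cmod (f i x) \<le> cmod (g x)"
  shows "(\<lambda>i. L2_norm M (\<lambda>x. f i x - g x)) \<longlonglongrightarrow> 0"
proof -
  note [measurable] = g[THEN L2_measurable]
  have "(\<lambda>i. LINT x|M. (cmod (f i x - g x))\<^sup>2) \<longlonglongrightarrow> (LINT x|M. 0)"
  proof (rule integral_dominated_convergence)
    show "integrable M (\<lambda>x. 4 * (cmod (g x))\<^sup>2)" using g by (simp add: L2_integrable_square)
    show "AE x in M. (\<lambda>i. (cmod (f i x - g x))\<^sup>2) \<longlonglongrightarrow> 0"
    proof (rule AE_I2)
      fix x assume "x \<in> space M"
      from tendsto_norm_zero[OF LIM_zero[OF lim[OF this]]]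
      have "(\<lambda>i. (cmod (f i x - g x))\<^sup>2) \<longlonglongrightarrow> 0\<^sup>2" by (rule tendsto_power)
      then show "(\<lambda>i. (cmod (f i x - g x))\<^sup>2) \<longlonglongrightarrow> 0" by simp
    qed
    show "AE x in M. norm ((cmod (f i x - g x))\<^sup>2) \<le> 4 * (cmod (g x))\<^sup>2" for i
    proof (rule AE_I2)
      fix x
      have "(cmod (f i x - g x))\<^sup>2 \<le> (2 * cmod (g x))\<^sup>2"
        using norm_triangle_ineq4[of "f i x" "g x"] bd[of i x] by (intro power_mono) auto
      then show "norm ((cmod (f i x - g x))\<^sup>2) \<le> 4 * (cmod (g x))\<^sup>2" by (simp add: power_mult_distrib)
    qed
  qed measurable
  then have "(\<lambda>i. sqrt (LINT x|M. (cmod (f i x - g x))\<^sup>2)) \<longlonglongrightarrow> sqrt 0"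
    by (intro tendsto_real_sqrt) simp
  then show ?thesis by (simp add: L2_norm_def)
qed

section \<open>Continuity of translation in the mean\<close>

lemma integral_lborel_shift:
  fixes f :: "real \<Rightarrow> 'b::{banach, second_countable_topology}"
  shows "(LINT x|lborel. f (x + t)) = (LINT x|lborel. f x)"
  using lborel_integral_real_affine[of 1 f t] by (simp add: add.commute)

lemma integrable_lborel_shift:
  fixes f :: "real \<Rightarrow> 'b::{banach, second_countable_topology}"
  shows "integrable lborel f \<Longrightarrow> integrable lborel (\<lambda>x. f (x + t))"
  using lborel_integrable_real_affine[of f 1 t] by (simp add: add.commute)

text \<open>For an open set the translates of its indicator converge pointwise on the set itself, which
  is enough because a translate has the same measure as the set.\<close>

lemma open_translation_continuous:
  fixes U :: "real set" and t :: "nat \<Rightarrow> real"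
  assumes U: "open U" "emeasure lborel U < \<infinity>" and t: "t \<longlonglongrightarrow> 0"
  shows "(\<lambda>n. LINT x|lborel. \<bar>indicat_real U (x + t n) - indicat_real U x\<bar>) \<longlonglongrightarrow> 0"
proof -
  let ?u = "indicat_real U"
  have [measurable]: "U \<in> sets borel" using U by simp
  have iu: "integrable lborel ?u" using U by (intro integrable_real_indicator) auto
  have iut: "integrable lborel (\<lambda>x. ?u (x + t n))" for n by (rule integrable_lborel_shift[OF iu])
  have ip: "integrable lborel (\<lambda>x. ?u (x + t n) * ?u x)" for n
    using iu by (rule Bochner_Integration.integrable_bound) (auto simp: indicator_def)
  have "(\<lambda>n. LINT x|lborel. ?u (x + t n) * ?u x) \<longlonglongrightarrow> (LINT x|lborel. ?u x)"
  proof (rule integral_dominated_convergence[where w="?u"])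
    show "AE x in lborel. (\<lambda>n. ?u (x + t n) * ?u x) \<longlonglongrightarrow> ?u x"
    proof (rule AE_I2)
      fix x show "(\<lambda>n. ?u (x + t n) * ?u x) \<longlonglongrightarrow> ?u x"
      proof (cases "x \<in> U")
        case True
        have "(\<lambda>n. x + t n) \<longlonglongrightarrow> x + 0" by (intro tendsto_intros t)
        then have "\<forall>\<^sub>F n in sequentially. x + t n \<in> U"
          using topological_tendstoD[OF _ U(1)] True by fastforce
        then have "\<forall>\<^sub>F n in sequentially. ?u (x + t n) * ?u x = ?u x"
          by eventually_elim (simp add: True)
        then show ?thesis by (rule tendsto_eventually)
      qed simp
    qed
  qed (auto simp: iu indicator_def)
  then have "(\<lambda>n. 2 * (LINT x|lborel. ?u x) - 2 * (LINT x|lborel. ?u (x + t n) * ?u x)) \<longlonglongrightarrow>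
      2 * (LINT x|lborel. ?u x) - 2 * (LINT x|lborel. ?u x)"
    by (intro tendsto_intros)
  \<comment> \<open>For a, b in {0, 1} one has |a - b| = a + b - 2ab, and the shifted indicator has
    the same integral as the original; only the integral of the product depends on
    \<open>t n\<close>.\<close>
  moreover have "(LINT x|lborel. \<bar>?u (x + t n) - ?u x\<bar>) =
      2 * (LINT x|lborel. ?u x) - 2 * (LINT x|lborel. ?u (x + t n) * ?u x)" for n
  proof -
    have "(LINT x|lborel. \<bar>?u (x + t n) - ?u x\<bar>) =
        (LINT x|lborel. ?u (x + t n) + ?u x - 2 * (?u (x + t n) * ?u x))"
      by (intro Bochner_Integration.integral_cong) (auto simp: indicator_def)
    also have "\<dots> = (LINT x|lborel. ?u (x + t n)) + (LINT x|lborel. ?u x)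
        - 2 * (LINT x|lborel. ?u (x + t n) * ?u x)"
      using iu iut ip by simp
    finally show ?thesis by (simp add: integral_lborel_shift)
  qed
  ultimately show ?thesis by simp
qed

text \<open>A three-epsilon argument: translation invariance makes the translated error
  \<open>f - g\<close> as small in L1 as the error itself, uniformly in the shift. It serves both
  the passage from open to Borel sets and the limit step of the induction over integrable
  functions.\<close>

lemma translation_continuous_approx:
  fixes f :: "real \<Rightarrow> 'b::{banach, second_countable_topology}" and t :: "nat \<Rightarrow> real"
  assumes f: "integrable lborel f"
    and approx: "\<And>e. e > 0 \<Longrightarrow> \<exists>g. integrable lborel g \<and> (LINT x|lborel. norm (f x - g x)) < e \<and>
      (\<lambda>n. LINT x|lborel. norm (g (x + t n) - g x)) \<longlonglongrightarrow> 0"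
  shows "(\<lambda>n. LINT x|lborel. norm (f (x + t n) - f x)) \<longlonglongrightarrow> 0"
proof (rule LIMSEQ_I)
  fix e :: real assume "e > 0"
  then obtain g where g: "integrable lborel g" "(LINT x|lborel. norm (f x - g x)) < e / 3"
      "(\<lambda>n. LINT x|lborel. norm (g (x + t n) - g x)) \<longlonglongrightarrow> 0"
    using approx[of "e / 3"] by auto
  have "0 < e / 3" using \<open>e > 0\<close> by simp
  from LIMSEQ_D[OF g(3) this] obtain N where
    N: "\<And>n. n \<ge> N \<Longrightarrow> (LINT x|lborel. norm (g (x + t n) - g x)) < e / 3"
    by (auto simp: abs_le_iff)
  show "\<exists>N. \<forall>n\<ge>N. norm ((LINT x|lborel. norm (f (x + t n) - f x)) - 0) < e"
  proof (intro exI allI impI)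
    fix n assume "n \<ge> N"
    note sh = integrable_lborel_shift
    have d: "integrable lborel (\<lambda>x. norm (f x - g x))" using f g by simp
    have "(LINT x|lborel. norm (f (x + t n) - f x)) \<le>
        (LINT x|lborel. norm (f (x + t n) - g (x + t n)) + norm (g (x + t n) - g x) + norm (f x - g x))"
    proof (rule integral_mono)
      show "norm (f (x + t n) - f x) \<le>
        norm (f (x + t n) - g (x + t n)) + norm (g (x + t n) - g x) + norm (f x - g x)" for x
        by norm
    qed (use f g sh[OF f] sh[OF g(1)] in auto)
    also have "\<dots> = (LINT x|lborel. norm (f (x + t n) - g (x + t n)))
        + (LINT x|lborel. norm (g (x + t n) - g x)) + (LINT x|lborel. norm (f x - g x))"
      using f g sh[OF f, of "t n"] sh[OF g(1), of "t n"] by simp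
    also have "(LINT x|lborel. norm (f (x + t n) - g (x + t n))) = (LINT x|lborel. norm (f x - g x))"
      by (rule integral_lborel_shift)
    finally show "norm ((LINT x|lborel. norm (f (x + t n) - f x)) - 0) < e"
      using g(2) N[OF \<open>n \<ge> N\<close>] by simp
  qed
qed

text \<open>Outer regularity provides an open superset \<open>U\<close> with \<open>U - A\<close> of
  measure below \<open>e\<close>, and the two indicators differ exactly by that of
  \<open>U - A\<close>.\<close>

lemma indicator_translation_continuous:
  fixes A :: "real set" and t :: "nat \<Rightarrow> real"
  assumes A: "A \<in> sets borel" "emeasure lborel A < \<infinity>" and t: "t \<longlonglongrightarrow> 0"
  shows "(\<lambda>n. LINT x|lborel. norm (indicat_real A (x + t n) - indicat_real A x)) \<longlonglongrightarrow> 0"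
proof (rule translation_continuous_approx)
  show "integrable lborel (indicat_real A)" using A by (intro integrable_real_indicator) auto
  fix e :: real assume e: "e > 0"
  obtain U where U: "open U" "A \<subseteq> U" "emeasure lborel (U - A) < e"
    using outer_regular_lborel[OF A(1) e] by blast
  have m: "U \<in> sets borel" "U - A \<in> sets borel" using U A by auto
  have fin: "emeasure lborel (U - A) < \<infinity>" using U(3) by (simp add: less_top order.strict_trans)
  have "emeasure lborel U = emeasure lborel A + emeasure lborel (U - A)"
    using U m A by (subst plus_emeasure) (auto simp: Un_absorb1)
  then have finU: "emeasure lborel U < \<infinity>" using fin A by simp
  have "(LINT x|lborel. norm (indicat_real A x - indicat_real U x)) = (LINT x|lborel. indicat_real (U - A) x)"
    using U by (intro Bochner_Integration.integral_cong) (auto simp: indicator_def)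
  also have "\<dots> = measure lborel (U - A)" using m by simp
  also have "\<dots> < e"
    using U(3) fin e by (simp add: emeasure_eq_ennreal_measure ennreal_less_iff)
  finally show "\<exists>g. integrable lborel g \<and> (LINT x|lborel. norm (indicat_real A x - g x)) < e \<and>
      (\<lambda>n. LINT x|lborel. norm (g (x + t n) - g x)) \<longlonglongrightarrow> 0"
    using open_translation_continuous[OF U(1) finU t] m finU
    by (intro exI[of _ "indicat_real U"]) (auto intro!: integrable_real_indicator)
qed

lemma L1_translation_continuous:
  fixes f :: "real \<Rightarrow> 'b::{banach, second_countable_topology}" and t :: "nat \<Rightarrow> real"
  assumes f: "integrable lborel f" and t: "t \<longlonglongrightarrow> 0"
  shows "(\<lambda>n. LINT x|lborel. norm (f (x + t n) - f x)) \<longlonglongrightarrow> 0"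
  using f
proof (induction rule: integrable_induct)
  case (base A c)
  have "(\<lambda>n. (LINT x|lborel. norm (indicat_real A (x + t n) - indicat_real A x)) * norm c) \<longlonglongrightarrow> 0 * norm c"
    using base by (intro tendsto_intros indicator_translation_continuous t) auto
  then show ?case by (simp flip: scaleR_diff_left)
next
  case (add f g)
  note sh = integrable_lborel_shift
  have lim: "(\<lambda>n. (LINT x|lborel. norm (f (x + t n) - f x)) + (LINT x|lborel. norm (g (x + t n) - g x))) \<longlonglongrightarrow> 0"
    using add by (intro tendsto_add_zero) auto
  show ?case
  proof (rule tendsto_sandwich[OF _ _ tendsto_const lim])
    show "\<forall>\<^sub>F n in sequentially. 0 \<le> (LINT x|lborel. norm (f (x + t n) + g (x + t n) - (f x + g x)))"
      by simp
    show "\<forall>\<^sub>F n in sequentially. (LINT x|lborel. norm (f (x + t n) + g (x + t n) - (f x + g x)))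
      \<le> (LINT x|lborel. norm (f (x + t n) - f x)) + (LINT x|lborel. norm (g (x + t n) - g x))"
    proof (rule always_eventually, rule allI)
      fix n
      have i: "integrable lborel (\<lambda>x. norm (f (x + t n) - f x))" "integrable lborel (\<lambda>x. norm (g (x + t n) - g x))"
        using add sh[of f] sh[of g] by auto
      have "(LINT x|lborel. norm (f (x + t n) + g (x + t n) - (f x + g x)))
        \<le> (LINT x|lborel. norm (f (x + t n) - f x) + norm (g (x + t n) - g x))"
        using i add sh[of f] sh[of g]
        by (intro integral_mono) (auto simp: add_diff_add norm_triangle_ineq)
      then show "(LINT x|lborel. norm (f (x + t n) + g (x + t n) - (f x + g x)))
        \<le> (LINT x|lborel. norm (f (x + t n) - f x)) + (LINT x|lborel. norm (g (x + t n) - g x))"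
        using i by simp
    qed
  qed
next
  case (lim f s)
  show ?case
  proof (rule translation_continuous_approx)
    fix e :: real assume "e > 0"
    have "(\<lambda>i. LINT x|lborel. norm (f x - s i x)) \<longlonglongrightarrow> (LINT x|(lborel::real measure). 0)"
    proof (rule integral_dominated_convergence[where w="\<lambda>x. 3 * norm (f x)"])
      show "AE x in lborel. (\<lambda>i. norm (f x - s i x)) \<longlonglongrightarrow> 0"
      proof (rule AE_I2)
        fix x :: real assume "x \<in> space lborel"
        then have "(\<lambda>i. norm (f x - s i x)) \<longlonglongrightarrow> norm (f x - f x)"
          by (intro tendsto_intros lim)
        then show "(\<lambda>i. norm (f x - s i x)) \<longlonglongrightarrow> 0" by simp
      qed
      \<comment> \<open>The induction rule supplies simple functions with
        \<open>norm (s i x) \<le> 2 * norm (f x)\<close>, which is the origin of the factor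
        3.\<close>
      show "AE x in lborel. norm (norm (f x - s i x)) \<le> 3 * norm (f x)" for i
      proof (rule AE_I2)
        fix x :: real
        have "norm (s i x) \<le> 2 * norm (f x)" using lim by simp
        then show "norm (norm (f x - s i x)) \<le> 3 * norm (f x)"
          using norm_triangle_ineq4[of "f x" "s i x"] by simp
      qed
    qed (use lim in auto)
    then have "\<forall>\<^sub>F i in sequentially. (LINT x|lborel. norm (f x - s i x)) < e"
      using \<open>e > 0\<close> by (intro order_tendstoD) auto
    then obtain i where "(LINT x|lborel. norm (f x - s i x)) < e"
      by (meson eventually_happens' sequentially_bot)
    with lim show "\<exists>g. integrable lborel g \<and> (LINT x|lborel. norm (f x - g x)) < e \<and>
      (\<lambda>n. LINT x|lborel. norm (g (x + t n) - g x)) \<longlonglongrightarrow> 0" by blast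
  qed fact
qed

lemma L2_shift: "f \<in> L2 lborel \<Longrightarrow> (\<lambda>x. f (x + t)) \<in> L2 lborel"
  unfolding L2_def using integrable_lborel_shift[of "\<lambda>x. (cmod (f x))\<^sup>2" t] by auto

lemma L2_norm_shift: "L2_norm lborel (\<lambda>x. f (x + t)) = L2_norm lborel f"
  unfolding L2_norm_def by (subst integral_lborel_shift) simp

text \<open>For a bounded function the squared difference is at most \<open>2 * M\<close> times the
  difference, so continuity in L1 implies continuity in L2.\<close>

lemma L2_translation_continuous_bounded:
  fixes f :: "real \<Rightarrow> complex" and t :: "nat \<Rightarrow> real"
  assumes f: "f \<in> L2 lborel" "integrable lborel f" and M: "\<And>x. cmod (f x) \<le> M" and t: "t \<longlonglongrightarrow> 0"
  shows "(\<lambda>n. L2_norm lborel (\<lambda>x. f (x + t n) - f x)) \<longlonglongrightarrow> 0"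
proof -
  let ?L = "\<lambda>n. LINT x|lborel. norm (f (x + t n) - f x)"
  have bd: "(L2_norm lborel (\<lambda>x. f (x + t n) - f x))\<^sup>2 \<le> 2 * M * ?L n" for n
  proof -
    have "(cmod (f (x + t n) - f x))\<^sup>2 \<le> 2 * M * cmod (f (x + t n) - f x)" for x
      unfolding power2_eq_square
      using norm_triangle_ineq4[of "f (x + t n)" "f x"] M[of x] M[of "x + t n"]
      by (intro mult_right_mono) auto
    moreover have "integrable lborel (\<lambda>x. (cmod (f (x + t n) - f x))\<^sup>2)"
      using L2_diff[OF L2_shift[OF f(1)] f(1)] by (rule L2_integrable_square)
    moreover have "integrable lborel (\<lambda>x. 2 * M * cmod (f (x + t n) - f x))"
      using f(2) integrable_lborel_shift[OF f(2), of "t n"] by auto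
    ultimately have "(LINT x|lborel. (cmod (f (x + t n) - f x))\<^sup>2) \<le> (LINT x|lborel. 2 * M * cmod (f (x + t n) - f x))"
      by (intro integral_mono) auto
    then show ?thesis by (simp add: L2_norm_square)
  qed
  have "(\<lambda>n. sqrt (2 * M * ?L n)) \<longlonglongrightarrow> sqrt (2 * M * 0)"
    by (intro tendsto_intros L1_translation_continuous f t)
  then have lim: "(\<lambda>n. sqrt (2 * M * ?L n)) \<longlonglongrightarrow> 0" by simp
  show ?thesis
    by (rule tendsto_sandwich[OF _ _ tendsto_const lim])
       (auto intro!: always_eventually real_le_rsqrt bd)
qed

lemma L2_translation_continuous:
  fixes f :: "real \<Rightarrow> complex" and t :: "nat \<Rightarrow> real"
  assumes f: "f \<in> L2 lborel" "integrable lborel f" and t: "t \<longlonglongrightarrow> 0"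
  shows "(\<lambda>n. L2_norm lborel (\<lambda>x. f (x + t n) - f x)) \<longlonglongrightarrow> 0"
proof (rule LIMSEQ_I)
  fix e :: real assume e: "e > 0"
  note [measurable] = L2_measurable[OF f(1)]
  \<comment> \<open>Cutting off large values gives functions bounded by \<open>k\<close> that stay
    integrable and converge to \<open>f\<close> in L2; the bounded case and a three-epsilon argument
    finish.\<close>
  define g where "g k x = (if cmod (f x) \<le> real k then f x else 0)" for k :: nat and x
  have [measurable]: "g k \<in> borel_measurable lborel" for k unfolding g_def by measurable
  have le: "cmod (g k x) \<le> cmod (f x)" for k x by (simp add: g_def)
  have g: "g k \<in> L2 lborel" for k
    by (intro L2I Bochner_Integration.integrable_bound[OF L2_integrable_square[OF f(1)]])
       (auto intro!: power_mono le)
  have gi: "integrable lborel (g k)" for k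
    by (rule Bochner_Integration.integrable_bound[OF f(2)]) (auto simp: le)
  have "(\<lambda>k. L2_norm lborel (\<lambda>x. g k x - f x)) \<longlonglongrightarrow> 0"
  proof (rule L2_dominated_convergence[OF f(1)])
    fix x
    obtain K where "cmod (f x) \<le> real K" using real_arch_simple by blast
    then have "\<forall>\<^sub>F k in sequentially. g k x = f x"
      unfolding eventually_sequentially g_def by (intro exI[of _ K]) auto
    then show "(\<lambda>k. g k x) \<longlonglongrightarrow> f x" by (rule tendsto_eventually)
  qed (auto simp: le)
  then have "\<forall>\<^sub>F k in sequentially. L2_norm lborel (\<lambda>x. g k x - f x) < e / 3"
    using e by (intro order_tendstoD) auto
  then obtain k where k: "L2_norm lborel (\<lambda>x. g k x - f x) < e / 3"
    by (meson eventually_happens' sequentially_bot)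
  have "cmod (g k x) \<le> real k" for x by (simp add: g_def)
  from L2_translation_continuous_bounded[OF g gi this t]
  have "\<forall>\<^sub>F n in sequentially. L2_norm lborel (\<lambda>x. g k (x + t n) - g k x) < e / 3"
    using e by (intro order_tendstoD) auto
  then obtain N where N: "\<And>n. n \<ge> N \<Longrightarrow> L2_norm lborel (\<lambda>x. g k (x + t n) - g k x) < e / 3"
    unfolding eventually_sequentially by blast
  show "\<exists>N. \<forall>n\<ge>N. norm (L2_norm lborel (\<lambda>x. f (x + t n) - f x) - 0) < e"
  proof (intro exI allI impI)
    fix n assume "n \<ge> N"
    note fs = L2_shift[OF f(1), of "t n"] and gs = L2_shift[OF g[of k], of "t n"]
    have "L2_norm lborel (\<lambda>x. f (x + t n) - f x) \<le>
        L2_norm lborel (\<lambda>x. f (x + t n) - g k (x + t n)) +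
        (L2_norm lborel (\<lambda>x. g k (x + t n) - g k x) + L2_norm lborel (\<lambda>x. g k x - f x))"
      using L2_norm_diff_triangle[OF fs gs f(1)] L2_norm_diff_triangle[OF gs g[of k] f(1)] by linarith
    moreover have "L2_norm lborel (\<lambda>x. f (x + t n) - g k (x + t n)) = L2_norm lborel (\<lambda>x. g k x - f x)"
      using L2_norm_shift[of "\<lambda>x. f x - g k x" "t n"] by (simp add: L2_norm_minus_commute)
    ultimately show "norm (L2_norm lborel (\<lambda>x. f (x + t n) - f x) - 0) < e"
      using k N[OF \<open>n \<ge> N\<close>] by simp
  qed
qed

section \<open>Plancherel for integrable functions\<close>

definition fourier_integral :: "(real \<Rightarrow> complex) \<Rightarrow> real \<Rightarrow> complex" where
  "fourier_integral f \<xi> = (LINT x|lborel. f x * cis (- (x * \<xi>)))"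

text \<open>This is the convolution of \<open>f\<close> with the reflected conjugate of
  \<open>f\<close>. Its value at 0 is the squared L2 norm, and for integrable \<open>f\<close> its
  transform is the squared modulus of that of \<open>f\<close>.\<close>

definition autocorrelation :: "(real \<Rightarrow> complex) \<Rightarrow> real \<Rightarrow> complex" where
  "autocorrelation f t = L2_inner lborel (\<lambda>y. f (y + t)) f"

lemma borel_measurable_cis [measurable (raw)]:
  "f \<in> borel_measurable M \<Longrightarrow> (\<lambda>x. cis (f x)) \<in> borel_measurable M"
  unfolding cis_conv_exp by measurable

lemma integrable_mult_cis:
  assumes "integrable M f" "g \<in> borel_measurable M"
  shows "integrable M (\<lambda>x. f x * cis (g x))"
  by (rule Bochner_Integration.integrable_bound[OF assms(1)])
     (use assms in \<open>auto simp: norm_mult\<close>)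

lemma fourier_integral_measurable:
  assumes [measurable]: "f \<in> borel_measurable lborel"
  shows "fourier_integral f \<in> borel_measurable lborel"
  unfolding fourier_integral_def[abs_def] by measurable

lemma norm_fourier_integral_le: "cmod (fourier_integral f \<xi>) \<le> (LINT x|lborel. cmod (f x))"
  unfolding fourier_integral_def
  using integral_norm_bound[of lborel "\<lambda>x. f x * cis (- (x * \<xi>))"] by (simp add: norm_mult)

text \<open>Integrating the modulus over \<open>t\<close> first removes the shift and leaves the L1
  norm of \<open>f\<close> times \<open>|f y|\<close>. Joint integrability then yields both
  integrability of the autocorrelation and the exchange of integrals in its transform.\<close>

lemma integrable_autocorrelation_kernel:
  fixes f :: "real \<Rightarrow> complex"
  assumes f: "integrable lborel f"
  shows "integrable (lborel \<Otimes>\<^sub>M lborel) (\<lambda>(y, t). f (y + t) * cnj (f y))"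
proof (rule lborel_pair.Fubini_integrable)
  have [measurable]: "f \<in> borel_measurable borel" using f by auto
  show "(\<lambda>(y, t). f (y + t) * cnj (f y)) \<in> borel_measurable (lborel \<Otimes>\<^sub>M lborel)" by measurable
  have "(LINT t|lborel. cmod (f (y + t))) = (LINT t|lborel. cmod (f t))" for y
    using integral_lborel_shift[of "\<lambda>t. cmod (f t)" y] by (simp add: add.commute)
  then show "integrable lborel (\<lambda>y. LINT t|lborel. norm (case (y, t) of (y, t) \<Rightarrow> f (y + t) * cnj (f y)))"
    using f by (simp add: norm_mult)
  show "AE y in lborel. integrable lborel (\<lambda>t. case (y, t) of (y, t) \<Rightarrow> f (y + t) * cnj (f y))"
    using integrable_lborel_shift[OF f] by (simp add: add.commute)
qed

lemma integrable_autocorrelation: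
  assumes f: "integrable lborel f"
  shows "integrable lborel (autocorrelation f)"
  unfolding autocorrelation_def[abs_def] L2_inner_def
  using lborel_pair.integrable_snd[OF integrable_autocorrelation_kernel[OF f]] by simp

lemma fourier_integral_autocorrelation:
  assumes f: "integrable lborel f"
  shows "fourier_integral (autocorrelation f) \<xi> = of_real ((cmod (fourier_integral f \<xi>))\<^sup>2)"
proof -
  have "integrable (lborel \<Otimes>\<^sub>M lborel)
      (\<lambda>z. (case z of (y, t) \<Rightarrow> f (y + t) * cnj (f y)) * cis (- (snd z * \<xi>)))"
    by (rule integrable_mult_cis[OF integrable_autocorrelation_kernel[OF f]]) measurable
  then have i: "integrable (lborel \<Otimes>\<^sub>M lborel)
      (\<lambda>(y, t). f (y + t) * cnj (f y) * cis (- (t * \<xi>)))"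
    by (simp add: case_prod_beta')
  have "fourier_integral (autocorrelation f) \<xi> =
      (LINT t|lborel. LINT y|lborel. f (y + t) * cnj (f y) * cis (- (t * \<xi>)))"
    unfolding fourier_integral_def autocorrelation_def L2_inner_def by simp
  also have "\<dots> = (LINT y|lborel. LINT t|lborel. f (y + t) * cnj (f y) * cis (- (t * \<xi>)))"
    by (rule lborel_pair.Fubini_integral[OF i])
  also have "\<dots> = (LINT y|lborel. cnj (f y * cis (- (y * \<xi>))) * fourier_integral f \<xi>)"
  proof (rule Bochner_Integration.integral_cong[OF refl])
    fix y
    \<comment> \<open>Writing exp(-i t \<xi>) as exp(i y \<xi>) exp(-i (t + y) \<xi>) separates the
      variables after the shift; the first factor belongs to the conjugated transform.\<close>
    have *: "f (y + t) * cnj (f y) * cis (- (t * \<xi>)) =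
        cnj (f y * cis (- (y * \<xi>))) * (f (t + y) * cis (- ((t + y) * \<xi>)))" for t
    proof -
      have "cis (y * \<xi>) * cis (- ((t + y) * \<xi>)) = cis (- (t * \<xi>))"
        by (simp add: cis_mult algebra_simps)
      then show ?thesis by (simp add: cis_cnj add.commute mult_ac)
    qed
    have "(LINT t|lborel. f (y + t) * cnj (f y) * cis (- (t * \<xi>))) =
        cnj (f y * cis (- (y * \<xi>))) * (LINT t|lborel. f (t + y) * cis (- ((t + y) * \<xi>)))"
      by (simp only: * integral_mult_right_zero)
    also have "(LINT t|lborel. f (t + y) * cis (- ((t + y) * \<xi>))) = fourier_integral f \<xi>"
      unfolding fourier_integral_def by (rule integral_lborel_shift)
    finally show "(LINT t|lborel. f (y + t) * cnj (f y) * cis (- (t * \<xi>))) =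
        cnj (f y * cis (- (y * \<xi>))) * fourier_integral f \<xi>" .
  qed
  also have "\<dots> = (LINT y|lborel. cnj (f y * cis (- (y * \<xi>)))) * fourier_integral f \<xi>"
    by simp
  also have "(LINT y|lborel. cnj (f y * cis (- (y * \<xi>)))) = cnj (fourier_integral f \<xi>)"
    unfolding fourier_integral_def by (rule Bochner_Integration.integral_cnj)
  finally show ?thesis by (simp only: complex_norm_square mult.commute)
qed

section \<open>Gaussian means and the multiplication formula\<close>

lemma integrable_gaussian:
  "e > 0 \<Longrightarrow> integrable lborel (\<lambda>x::real. exp (- (e * x)\<^sup>2 / 2))"
proof -
  assume e: "e > 0"
  have "integrable lborel (\<lambda>x. sqrt (2 * pi) * std_normal_density x)"
    by (intro integrable_mult_right integrable_normal_density) auto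
  then have "integrable lborel (\<lambda>x::real. exp (- x\<^sup>2 / 2))"
    by (simp add: std_normal_density_def)
  from lborel_integrable_real_affine[OF this, of e 0] e show ?thesis by simp
qed

text \<open>Up to the factor sqrt(2 pi), this is the characteristic function of the standard normal
  distribution at \<open>- t\<close>.\<close>

lemma fourier_integral_std_gaussian:
  "fourier_integral (\<lambda>x. of_real (exp (- x\<^sup>2 / 2))) t = of_real (sqrt (2 * pi) * exp (- t\<^sup>2 / 2))"
proof -
  have "char std_normal_distribution (- t) = (LINT x|lborel. std_normal_density x *\<^sub>R iexp (- t * x))"
    unfolding char_def by (subst integral_density) auto
  also have "\<dots> = (LINT x|lborel. (1 / sqrt (2 * pi)) *\<^sub>R (of_real (exp (- x\<^sup>2 / 2)) * cis (- (x * t))))"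
    by (intro Bochner_Integration.integral_cong)
       (auto simp: std_normal_density_def cis_conv_exp scaleR_conv_of_real mult_ac)
  also have "\<dots> = (1 / sqrt (2 * pi)) *\<^sub>R fourier_integral (\<lambda>x. of_real (exp (- x\<^sup>2 / 2))) t"
    unfolding fourier_integral_def by simp
  finally show ?thesis
    by (simp add: char_std_normal_distribution scaleR_conv_of_real field_simps)
qed

lemma fourier_integral_gaussian:
  assumes e: "e > 0"
  shows "fourier_integral (\<lambda>x. of_real (exp (- (e * x)\<^sup>2 / 2))) t =
    of_real (sqrt (2 * pi) / e * exp (- (t / e)\<^sup>2 / 2))"
proof -
  have "fourier_integral (\<lambda>x. of_real (exp (- x\<^sup>2 / 2))) (t / e) =
      e *\<^sub>R fourier_integral (\<lambda>x. of_real (exp (- (e * x)\<^sup>2 / 2))) t"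
    unfolding fourier_integral_def
    by (subst lborel_integral_real_affine[of e _ 0]) (use e in auto)
  then show ?thesis using e unfolding fourier_integral_std_gaussian
    by (simp add: scaleR_conv_of_real field_simps)
qed

text \<open>Fubini on the product of two integrable functions moves the transform from one factor to
  the other. It is applied to a Gaussian weight here, and later to band-limited factors, where it
  produces the sinc kernel.\<close>

lemma fourier_integral_multiplication:
  assumes f: "integrable lborel f" and g: "integrable lborel g"
  shows "(LINT \<xi>|lborel. g \<xi> * fourier_integral f \<xi>) = (LINT t|lborel. f t * fourier_integral g t)"
proof -
  have [measurable]: "f \<in> borel_measurable borel" "g \<in> borel_measurable borel" using f g by auto
  have i: "integrable (lborel \<Otimes>\<^sub>M lborel) (\<lambda>(t, \<xi>). f t * g \<xi> * cis (- (t * \<xi>)))"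
  proof (rule lborel_pair.Fubini_integrable)
    show "(\<lambda>(t, \<xi>). f t * g \<xi> * cis (- (t * \<xi>))) \<in> borel_measurable (lborel \<Otimes>\<^sub>M lborel)" by measurable
    show "integrable lborel (\<lambda>t. LINT \<xi>|lborel. norm (case (t, \<xi>) of (t, \<xi>) \<Rightarrow> f t * g \<xi> * cis (- (t * \<xi>))))"
      using f by (simp add: norm_mult)
    show "AE t in lborel. integrable lborel (\<lambda>\<xi>. case (t, \<xi>) of (t, \<xi>) \<Rightarrow> f t * g \<xi> * cis (- (t * \<xi>)))"
      using g by (auto intro!: integrable_mult_cis)
  qed
  have "(LINT \<xi>|lborel. g \<xi> * fourier_integral f \<xi>) =
      (LINT \<xi>|lborel. LINT t|lborel. f t * g \<xi> * cis (- (t * \<xi>)))"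
    unfolding fourier_integral_def by (simp add: mult_ac flip: integral_mult_right_zero)
  also have "\<dots> = (LINT t|lborel. LINT \<xi>|lborel. f t * g \<xi> * cis (- (t * \<xi>)))"
    by (rule lborel_pair.Fubini_integral[OF i])
  also have "\<dots> = (LINT t|lborel. f t * fourier_integral g t)"
    unfolding fourier_integral_def by (simp add: mult_ac flip: integral_mult_right_zero)
  finally show ?thesis .
qed

text \<open>The multiplication formula turns the wide Gaussian in \<xi> into a narrow one against
  the autocorrelation. Rescaling by \<open>e\<close> fixes the density, so that as \<open>e\<close>
  tends to 0 only the argument of the autocorrelation shrinks.\<close>

lemma gaussian_mean_fourier_integral:
  assumes f: "integrable lborel f" and e: "e > 0"
  shows "(LINT \<xi>|lborel. exp (- (e * \<xi>)\<^sup>2 / 2) * (cmod (fourier_integral f \<xi>))\<^sup>2) =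
    2 * pi * (LINT u|lborel. std_normal_density u * Re (autocorrelation f (e * u)))"
    (is "?L = 2 * pi * ?R")
proof -
  let ?A = "autocorrelation f" and ?w = "\<lambda>x. complex_of_real (exp (- (e * x)\<^sup>2 / 2))"
  note A = integrable_autocorrelation[OF f]
  have w: "integrable lborel ?w" by (intro integrable_of_real integrable_gaussian e)
  have [measurable]: "?A \<in> borel_measurable borel" using A by auto
  have iA: "integrable lborel (\<lambda>u. std_normal_density u * ?A (e * u))"
  proof (rule Bochner_Integration.integrable_bound)
    show "integrable lborel (\<lambda>u. (1 / sqrt (2 * pi)) *\<^sub>R ?A (e * u))"
      using lborel_integrable_real_affine[OF A, of e 0] e by simp
    have "std_normal_density u \<le> 1 / sqrt (2 * pi)" for u
      by (simp add: std_normal_density_def divide_right_mono)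
    then show "AE u in lborel. norm (std_normal_density u * ?A (e * u)) \<le> norm ((1 / sqrt (2 * pi)) *\<^sub>R ?A (e * u))"
      by (intro AE_I2) (simp only: norm_mult norm_scaleR norm_of_real, intro mult_right_mono, auto)
  qed measurable
  have "complex_of_real ?L = (LINT \<xi>|lborel. complex_of_real (exp (- (e * \<xi>)\<^sup>2 / 2) * (cmod (fourier_integral f \<xi>))\<^sup>2))"
    by (rule integral_complex_of_real[symmetric])
  also have "\<dots> = (LINT \<xi>|lborel. ?w \<xi> * fourier_integral ?A \<xi>)"
    by (simp add: fourier_integral_autocorrelation[OF f])
  also have "\<dots> = (LINT t|lborel. ?A t * fourier_integral ?w t)"
    by (rule fourier_integral_multiplication[OF A w])
  also have "\<dots> = e *\<^sub>R (LINT u|lborel. ?A (e * u) * of_real (sqrt (2 * pi) / e * exp (- u\<^sup>2 / 2)))"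
    unfolding fourier_integral_gaussian[OF e]
    by (subst lborel_integral_real_affine[of e _ 0]) (use e in auto)
  also have "\<dots> = e *\<^sub>R (LINT u|lborel. (2 * pi / e) *\<^sub>R (std_normal_density u * ?A (e * u)))"
  proof (intro arg_cong[where f="(*\<^sub>R) e"] Bochner_Integration.integral_cong[OF refl])
    fix u
    \<comment> \<open>Here the Plancherel constant appears: one sqrt(2 pi) comes from transforming
      the Gaussian, the other from normalizing the density. The Jacobian \<open>e\<close> of the
      substitution cancels \<open>1 / e\<close>.\<close>
    have *: "sqrt (2 * pi) / e * exp (- u\<^sup>2 / 2) = 2 * pi / e * std_normal_density u"
      using e by (simp add: std_normal_density_def field_simps real_sqrt_mult)
    show "?A (e * u) * of_real (sqrt (2 * pi) / e * exp (- u\<^sup>2 / 2)) =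
        (2 * pi / e) *\<^sub>R (std_normal_density u * ?A (e * u))"
      unfolding * scaleR_conv_of_real of_real_mult by (simp add: mult_ac)
  qed
  also have "\<dots> = (2 * pi) *\<^sub>R (LINT u|lborel. std_normal_density u * ?A (e * u))"
    using e by simp
  finally have "Re (complex_of_real ?L) = Re ((2 * pi) *\<^sub>R (LINT u|lborel. std_normal_density u * ?A (e * u)))"
    by (rule arg_cong)
  then have "?L = Re ((2 * pi) *\<^sub>R (LINT u|lborel. std_normal_density u * ?A (e * u)))"
    by (simp only: Re_complex_of_real)
  also have "\<dots> = 2 * pi * (LINT u|lborel. Re (std_normal_density u * ?A (e * u)))"
    by (simp only: scaleR_complex.sel integral_Re[OF iA])
  finally show ?thesis by simp
qed

text \<open>Expanding the squared norm of the difference of a translate and \<open>f\<close>, which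
  have equal norms, reduces continuity of the autocorrelation at 0 to continuity of translation in
  L2.\<close>

lemma Re_autocorrelation:
  assumes f: "f \<in> L2 lborel"
  shows "Re (autocorrelation f t) =
    (L2_norm lborel f)\<^sup>2 - (L2_norm lborel (\<lambda>x. f (x + t) - f x))\<^sup>2 / 2"
proof -
  have "L2_inner lborel (\<lambda>y. f (y + t)) (\<lambda>x. - 1 * f x) = - L2_inner lborel (\<lambda>y. f (y + t)) f"
    unfolding L2_inner_def by simp
  then show ?thesis
    using L2_norm_add_square[OF L2_shift[OF f, of t] L2_scale[OF f, of "-1"]]
    by (simp add: autocorrelation_def L2_norm_shift L2_norm_scale[of _ "- 1", simplified] field_simps)
qed

theorem fourier_integral_Plancherel:
  assumes f: "f \<in> L2 lborel" "integrable lborel f"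
  shows "fourier_integral f \<in> L2 lborel"
    and "(L2_norm lborel (fourier_integral f))\<^sup>2 = 2 * pi * (L2_norm lborel f)\<^sup>2"
proof -
  define e where "e n = inverse (real (Suc n))" for n
  have e: "e n > 0" for n by (simp add: e_def)
  have lime: "e \<longlonglongrightarrow> 0" unfolding e_def by (rule LIMSEQ_inverse_real_of_nat)
  let ?F = "fourier_integral f" and ?S = "(L2_norm lborel f)\<^sup>2"
  have [measurable]: "f \<in> borel_measurable borel" using f by auto
  have [measurable]: "?F \<in> borel_measurable borel" using fourier_integral_measurable[of f] by simp
  have [measurable]: "autocorrelation f \<in> borel_measurable borel"
    using integrable_autocorrelation[OF f(2)] by auto
  \<comment> \<open>By Cauchy-Schwarz the autocorrelation never exceeds its value at 0, which gives
    an integrable bound independent of \<open>n\<close>.\<close>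
  have bd: "norm (std_normal_density u * Re (autocorrelation f (e n * u))) \<le> std_normal_density u * ?S" for u n
  proof -
    have "cmod (autocorrelation f t) \<le> ?S" for t
      unfolding autocorrelation_def
      using L2_Cauchy_Schwarz[OF L2_shift[OF f(1), of t] f(1)]
      by (simp add: L2_norm_shift power2_eq_square)
    then have "\<bar>Re (autocorrelation f (e n * u))\<bar> \<le> ?S" using abs_Re_le_cmod order_trans by blast
    then show ?thesis by (simp add: abs_mult mult_left_mono)
  qed
  have "(\<lambda>n. LINT u|lborel. std_normal_density u * Re (autocorrelation f (e n * u))) \<longlonglongrightarrow>
      (LINT u|lborel. std_normal_density u * ?S)"
  proof (rule integral_dominated_convergence[where w="\<lambda>u. std_normal_density u * ?S"])
    show "AE u in lborel. (\<lambda>n. std_normal_density u * Re (autocorrelation f (e n * u))) \<longlonglongrightarrow> std_normal_density u * ?S"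
    proof (rule AE_I2)
      fix u :: real
      have "(\<lambda>n. e n * u) \<longlonglongrightarrow> 0" using tendsto_mult_left_zero[OF lime] by simp
      note L2_translation_continuous[OF f this]
      then have "(\<lambda>n. std_normal_density u * (?S - (L2_norm lborel (\<lambda>x. f (x + e n * u) - f x))\<^sup>2 / 2))
          \<longlonglongrightarrow> std_normal_density u * (?S - 0\<^sup>2 / 2)" by (intro tendsto_intros) auto
      then show "(\<lambda>n. std_normal_density u * Re (autocorrelation f (e n * u))) \<longlonglongrightarrow> std_normal_density u * ?S"
        unfolding Re_autocorrelation[OF f(1)] by simp
    qed
  qed (auto simp: integrable_normal_density bd[unfolded real_norm_def])
  moreover have "(LINT u|lborel. std_normal_density u * ?S) = ?S"
    by (simp add: integral_normal_density)
  ultimately have lim: "(\<lambda>n. LINT \<xi>|lborel. exp (- (e n * \<xi>)\<^sup>2 / 2) * (cmod (?F \<xi>))\<^sup>2) \<longlonglongrightarrow> 2 * pi * ?S"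
    unfolding gaussian_mean_fourier_integral[OF f(2) e] by (intro tendsto_intros) simp
  \<comment> \<open>The transform is bounded by the L1 norm of \<open>f\<close>, so each weighted
    integrand is dominated by a multiple of a Gaussian.\<close>
  have i: "integrable lborel (\<lambda>\<xi>. exp (- (e n * \<xi>)\<^sup>2 / 2) * (cmod (?F \<xi>))\<^sup>2)" for n
  proof (rule Bochner_Integration.integrable_bound)
    let ?B = "(LINT x|lborel. cmod (f x))\<^sup>2"
    show "integrable lborel (\<lambda>\<xi>. exp (- (e n * \<xi>)\<^sup>2 / 2) * ?B)"
      using integrable_gaussian[OF e] by simp
    have "(cmod (?F \<xi>))\<^sup>2 \<le> ?B" for \<xi> by (intro power_mono norm_fourier_integral_le) auto
    then show "AE \<xi> in lborel. norm (exp (- (e n * \<xi>)\<^sup>2 / 2) * (cmod (?F \<xi>))\<^sup>2) \<le> norm (exp (- (e n * \<xi>)\<^sup>2 / 2) * ?B)"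
      by (auto simp: abs_mult intro!: mult_left_mono AE_I2)
  qed measurable
  \<comment> \<open>Since \<open>e\<close> decreases to 0, the weights increase to 1. Monotone
    convergence, with the limit of the integrals already known, yields integrability and the
    integral at once.\<close>
  have mono: "mono (\<lambda>n. exp (- (e n * \<xi>)\<^sup>2 / 2) * (cmod (?F \<xi>))\<^sup>2)" for \<xi>
  proof (rule monoI)
    fix m n :: nat assume "m \<le> n"
    then have "e n \<le> e m" by (simp add: e_def le_imp_inverse_le)
    then have "(e n)\<^sup>2 * \<xi>\<^sup>2 \<le> (e m)\<^sup>2 * \<xi>\<^sup>2" using e[of n] by (intro mult_right_mono power_mono) auto
    then show "exp (- (e m * \<xi>)\<^sup>2 / 2) * (cmod (?F \<xi>))\<^sup>2 \<le> exp (- (e n * \<xi>)\<^sup>2 / 2) * (cmod (?F \<xi>))\<^sup>2"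
      by (intro mult_right_mono) (auto simp: power_mult_distrib)
  qed
  have pt: "(\<lambda>n. exp (- (e n * \<xi>)\<^sup>2 / 2) * (cmod (?F \<xi>))\<^sup>2) \<longlonglongrightarrow> (cmod (?F \<xi>))\<^sup>2" for \<xi>
  proof -
    have "(\<lambda>n. exp (- (e n * \<xi>)\<^sup>2 / 2) * (cmod (?F \<xi>))\<^sup>2) \<longlonglongrightarrow> exp (- (0 * \<xi>)\<^sup>2 / 2) * (cmod (?F \<xi>))\<^sup>2"
      by (intro tendsto_intros lime) auto
    then show ?thesis by simp
  qed
  have "integrable lborel (\<lambda>\<xi>. (cmod (?F \<xi>))\<^sup>2)" "(LINT \<xi>|lborel. (cmod (?F \<xi>))\<^sup>2) = 2 * pi * ?S"
    by (rule integral_monotone_convergence_nonneg[OF i _ _ _ lim]; use mono pt in simp)+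
  then show "?F \<in> L2 lborel" "(L2_norm lborel ?F)\<^sup>2 = 2 * pi * ?S"
    unfolding L2_norm_square by (auto intro: L2I)
qed

section \<open>The Fourier transform on $L^2$\<close>

lemma L2_restrict_space:
  assumes f: "f \<in> L2 M" and A: "A \<in> sets M"
  shows "f \<in> L2 (restrict_space M A)" "L2_norm (restrict_space M A) f \<le> L2_norm M f"
proof -
  have A': "A \<inter> space M \<in> sets M" using A by auto
  note [measurable] = L2_measurable[OF f] A
  have i: "integrable M (\<lambda>x. indicator A x *\<^sub>R (cmod (f x))\<^sup>2)"
    by (rule integrable_mult_indicator[OF A L2_integrable_square[OF f]])
  show "f \<in> L2 (restrict_space M A)"
    by (intro L2I measurable_restrict_space1) (auto simp: integrable_restrict_space[OF A'] i[unfolded real_scaleR_def])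
  show "L2_norm (restrict_space M A) f \<le> L2_norm M f"
    unfolding L2_norm_def integral_restrict_space[OF A']
    by (intro real_sqrt_le_mono integral_mono i L2_integrable_square f) (auto simp: indicator_def)
qed

lemma L2_norm_restrict_space_square:
  assumes "A \<in> sets M"
  shows "(L2_norm (restrict_space M A) f)\<^sup>2 = (LINT x|M. indicator A x *\<^sub>R (cmod (f x))\<^sup>2)"
  unfolding L2_norm_square by (rule integral_restrict_space) (use assms in auto)

lemma L2_inner_restrict_space:
  assumes "A \<in> sets M"
  shows "L2_inner (restrict_space M A) f g = (LINT x|M. indicator A x *\<^sub>R (f x * cnj (g x)))"
  unfolding L2_inner_def by (rule integral_restrict_space) (use assms in auto)

lemma L2_inner_split:
  assumes f: "f \<in> L2 M" and g: "g \<in> L2 M" and A: "A \<in> sets M"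
  shows "L2_inner M f g =
    L2_inner (restrict_space M A) f g + L2_inner (restrict_space M (space M - A)) f g"
proof -
  have A': "space M - A \<in> sets M" using A by auto
  note i = L2_mult_integrable[OF f g]
  have "L2_inner M f g = (LINT x|M. indicator A x *\<^sub>R (f x * cnj (g x))
      + indicator (space M - A) x *\<^sub>R (f x * cnj (g x)))"
    unfolding L2_inner_def by (intro Bochner_Integration.integral_cong) (auto simp: indicator_def)
  also have "\<dots> = L2_inner (restrict_space M A) f g + L2_inner (restrict_space M (space M - A)) f g"
    unfolding L2_inner_restrict_space[OF A] L2_inner_restrict_space[OF A']
    by (intro Bochner_Integration.integral_add integrable_mult_indicator A A' i)
  finally show ?thesis .
qed

lemma fourier_integral_scale: "fourier_integral (\<lambda>x. a * f x) \<xi> = a * fourier_integral f \<xi>"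
  unfolding fourier_integral_def by (simp add: mult.assoc)

lemma fourier_integral_add:
  assumes "integrable lborel f" "integrable lborel g"
  shows "fourier_integral (\<lambda>x. f x + g x) \<xi> = fourier_integral f \<xi> + fourier_integral g \<xi>"
  unfolding fourier_integral_def using assms
  by (simp add: distrib_right integrable_mult_cis)

lemma fourier_integral_diff:
  assumes "integrable lborel f" "integrable lborel g"
  shows "fourier_integral (\<lambda>x. f x - g x) \<xi> = fourier_integral f \<xi> - fourier_integral g \<xi>"
  unfolding fourier_integral_def using assms
  by (simp add: left_diff_distrib integrable_mult_cis)

lemma fourier_integral_sum:
  assumes "\<And>i. i \<in> A \<Longrightarrow> integrable lborel (f i)"
  shows "fourier_integral (\<lambda>x. \<Sum>i\<in>A. f i x) \<xi> = (\<Sum>i\<in>A. fourier_integral (f i) \<xi>)"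
  unfolding fourier_integral_def using assms
  by (simp add: sum_distrib_right integrable_mult_cis Bochner_Integration.integral_sum)

lemma truncated_fourier_eq:
  "truncated_fourier F R = fourier_integral (\<lambda>x. indicator {-R..R} x * F x)"
proof
  fix \<xi> show "truncated_fourier F R \<xi> = fourier_integral (\<lambda>x. indicator {-R..R} x * F x) \<xi>"
    unfolding truncated_fourier_def fourier_integral_def set_lebesgue_integral_def
    by (intro Bochner_Integration.integral_cong) (auto simp: cis_conv_exp indicator_def)
qed

lemma L2_truncation:
  assumes F: "F \<in> L2 lborel"
  shows "(\<lambda>x. indicator {-R..R} x * F x) \<in> L2 lborel"
  by (rule L2_bounded_mult[OF F]) (auto simp: indicator_def)

text \<open>The indicator of a bounded interval is in L2, and a product of two L2 functions is
  integrable.\<close>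

lemma integrable_truncation:
  fixes F :: "real \<Rightarrow> complex"
  assumes F: "F \<in> L2 lborel"
  shows "integrable lborel (\<lambda>x. indicator {-R..R} x * F x)"
proof -
  have "(\<lambda>x. indicator {-R..R} x :: complex) \<in> L2 lborel"
  proof (rule L2I)
    have "integrable lborel (indicat_real {-R..R})" by (intro integrable_real_indicator) (auto simp: emeasure_lborel_Icc_eq)
    then show "integrable lborel (\<lambda>x. (cmod (indicator {-R..R} x))\<^sup>2)"
      by (rule Bochner_Integration.integrable_bound) (auto simp: indicator_def)
  qed auto
  moreover have "F x * cnj (indicator {-R..R} x) = indicator {-R..R} x * F x" for x
    by (simp add: indicator_def)
  ultimately show ?thesis using L2_mult_integrable[OF F, of "indicator {-R..R}"] by (simp only:)
qed

lemma truncated_fourier_Plancherel: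
  assumes F: "F \<in> L2 lborel"
  shows "truncated_fourier F R \<in> L2 lborel"
    and "(L2_norm lborel (truncated_fourier F R))\<^sup>2 =
      2 * pi * (L2_norm lborel (\<lambda>x. indicator {-R..R} x * F x))\<^sup>2"
  unfolding truncated_fourier_eq
  by (rule fourier_integral_Plancherel[OF L2_truncation[OF F] integrable_truncation[OF F]])+

text \<open>The defining integral takes extended nonnegative values. Plancherel for truncations puts
  the truncated transforms into L2, so that integral is finite and can be replaced by a real
  norm.\<close>

lemma has_fourier_transform_iff:
  "has_fourier_transform F G \<longleftrightarrow> F \<in> L2 lborel \<and> G \<in> L2 lborel \<and>
    ((\<lambda>R. L2_norm lborel (\<lambda>\<xi>. truncated_fourier F R \<xi> - G \<xi>)) \<longlongrightarrow> 0) at_top"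
proof (cases "F \<in> L2 lborel \<and> G \<in> L2 lborel")
  case True
  let ?n = "\<lambda>R. L2_norm lborel (\<lambda>\<xi>. truncated_fourier F R \<xi> - G \<xi>)"
  have "(\<integral>\<^sup>+ \<xi>. ennreal ((cmod (truncated_fourier F R \<xi> - G \<xi>))\<^sup>2) \<partial>lborel) = ennreal ((?n R)\<^sup>2)" for R
    using True by (intro nn_integral_L2_norm L2_diff truncated_fourier_Plancherel) auto
  then have "has_fourier_transform F G \<longleftrightarrow> ((\<lambda>R. ennreal ((?n R)\<^sup>2)) \<longlongrightarrow> ennreal 0) at_top"
    using True by (simp add: has_fourier_transform_def)
  also have "\<dots> \<longleftrightarrow> ((\<lambda>R. (?n R)\<^sup>2) \<longlongrightarrow> 0) at_top"
    by (rule tendsto_ennreal_iff) auto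
  also have "\<dots> \<longleftrightarrow> (?n \<longlongrightarrow> 0) at_top"
  proof
    assume "((\<lambda>R. (?n R)\<^sup>2) \<longlongrightarrow> 0) at_top"
    then have "((\<lambda>R. sqrt ((?n R)\<^sup>2)) \<longlongrightarrow> sqrt 0) at_top" by (rule tendsto_real_sqrt)
    then show "(?n \<longlongrightarrow> 0) at_top" by simp
  next
    assume "(?n \<longlongrightarrow> 0) at_top"
    then have "((\<lambda>R. (?n R)\<^sup>2) \<longlongrightarrow> 0\<^sup>2) at_top" by (rule tendsto_power)
    then show "((\<lambda>R. (?n R)\<^sup>2) \<longlongrightarrow> 0) at_top" by simp
  qed
  finally show ?thesis using True by simp
qed (auto simp: has_fourier_transform_def)

lemma has_fourier_transform_Plancherel:
  assumes "has_fourier_transform F G"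
  shows "(L2_norm lborel G)\<^sup>2 = 2 * pi * (L2_norm lborel F)\<^sup>2"
proof -
  from assms have F: "F \<in> L2 lborel" and G: "G \<in> L2 lborel"
    and lim: "((\<lambda>R. L2_norm lborel (\<lambda>\<xi>. truncated_fourier F R \<xi> - G \<xi>)) \<longlongrightarrow> 0) at_top"
    by (auto simp: has_fourier_transform_iff)
  \<comment> \<open>Restricting \<open>R\<close> to the natural numbers makes sequential dominated
    convergence available for the truncations of \<open>F\<close>. The norms of the truncated
    transforms then have two limits, which must agree.\<close>
  have "(\<lambda>n. L2_norm lborel (\<lambda>\<xi>. truncated_fourier F (real n) \<xi> - G \<xi>)) \<longlonglongrightarrow> 0"
    by (rule filterlim_compose[OF lim filterlim_real_sequentially])
  then have "(\<lambda>n. L2_norm lborel (truncated_fourier F (real n))) \<longlonglongrightarrow> L2_norm lborel G"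
    by (intro tendsto_L2_norm G always_eventually allI truncated_fourier_Plancherel F)
  then have 1: "(\<lambda>n. (L2_norm lborel (truncated_fourier F (real n)))\<^sup>2) \<longlonglongrightarrow> (L2_norm lborel G)\<^sup>2"
    by (rule tendsto_power)
  let ?c = "\<lambda>n x. indicator {- real n..real n} x * F x"
  have "(\<lambda>n. L2_norm lborel (\<lambda>x. ?c n x - F x)) \<longlonglongrightarrow> 0"
  proof (rule L2_dominated_convergence[OF F])
    fix x :: real
    obtain K where "\<bar>x\<bar> \<le> real K" using real_arch_simple by blast
    then have "\<forall>\<^sub>F n in sequentially. ?c n x = F x"
      unfolding eventually_sequentially by (intro exI[of _ K]) (auto simp: indicator_def abs_le_iff)
    then show "(\<lambda>n. ?c n x) \<longlonglongrightarrow> F x" by (rule tendsto_eventually)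
  next
    show "?c n \<in> borel_measurable lborel" for n by (rule L2_measurable[OF L2_truncation[OF F]])
  qed (auto simp: indicator_def)
  then have "(\<lambda>n. L2_norm lborel (?c n)) \<longlonglongrightarrow> L2_norm lborel F"
    by (intro tendsto_L2_norm F always_eventually allI L2_truncation)
  then have 2: "(\<lambda>n. (L2_norm lborel (truncated_fourier F (real n)))\<^sup>2) \<longlonglongrightarrow> 2 * pi * (L2_norm lborel F)\<^sup>2"
    unfolding truncated_fourier_Plancherel(2)[OF F] by (intro tendsto_intros)
  show ?thesis using LIMSEQ_unique[OF 1 2] .
qed

lemma has_fourier_transform_add:
  assumes "has_fourier_transform F G" "has_fourier_transform F' G'"
  shows "has_fourier_transform (\<lambda>x. F x + F' x) (\<lambda>\<xi>. G \<xi> + G' \<xi>)"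
proof -
  let ?n = "\<lambda>F G R. L2_norm lborel (\<lambda>\<xi>. truncated_fourier F R \<xi> - G \<xi>)"
  from assms have L: "F \<in> L2 lborel" "F' \<in> L2 lborel" "G \<in> L2 lborel" "G' \<in> L2 lborel"
    and lim: "(?n F G \<longlongrightarrow> 0) at_top" "(?n F' G' \<longlongrightarrow> 0) at_top"
    by (auto simp: has_fourier_transform_iff)
  have le: "?n (\<lambda>x. F x + F' x) (\<lambda>\<xi>. G \<xi> + G' \<xi>) R \<le> ?n F G R + ?n F' G' R" for R
  proof -
    have "truncated_fourier (\<lambda>x. F x + F' x) R \<xi> = truncated_fourier F R \<xi> + truncated_fourier F' R \<xi>" for \<xi>
      unfolding truncated_fourier_eq
      by (simp add: distrib_left fourier_integral_add[OF integrable_truncation integrable_truncation] L)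
    then show ?thesis
      using L2_norm_triangle[OF L2_diff[OF truncated_fourier_Plancherel(1)[OF L(1)] L(3)]
        L2_diff[OF truncated_fourier_Plancherel(1)[OF L(2)] L(4)], of R R]
      by (simp add: algebra_simps)
  qed
  have "((\<lambda>R. ?n F G R + ?n F' G' R) \<longlongrightarrow> 0) at_top" using lim by (rule tendsto_add_zero)
  then have "(?n (\<lambda>x. F x + F' x) (\<lambda>\<xi>. G \<xi> + G' \<xi>) \<longlongrightarrow> 0) at_top"
    by (rule Lim_null_comparison[rotated]) (simp add: le)
  then show ?thesis by (simp add: has_fourier_transform_iff L L2_add)
qed

text \<open>Plancherel for the sum, minus Plancherel for each summand, leaves the cross terms. Their
  real parts suffice because the quantity to be estimated is a squared norm.\<close>

lemma has_fourier_transform_Parseval: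
  assumes "has_fourier_transform F G" "has_fourier_transform F' G'"
  shows "Re (L2_inner lborel G G') = 2 * pi * Re (L2_inner lborel F F')"
proof -
  have L: "F \<in> L2 lborel" "F' \<in> L2 lborel" "G \<in> L2 lborel" "G' \<in> L2 lborel"
    using assms by (auto simp: has_fourier_transform_iff)
  show ?thesis
    using has_fourier_transform_Plancherel[OF has_fourier_transform_add[OF assms]]
      has_fourier_transform_Plancherel[OF assms(1)] has_fourier_transform_Plancherel[OF assms(2)]
    unfolding L2_norm_add_square[OF L(1,2)] L2_norm_add_square[OF L(3,4)]
    by (simp add: distrib_left)
qed

lemma has_fourier_transform_unique:
  assumes "has_fourier_transform F G" "has_fourier_transform F G'"
  shows "AE \<xi> in lborel. G \<xi> = G' \<xi>"
proof -
  let ?n = "\<lambda>G R. L2_norm lborel (\<lambda>\<xi>. truncated_fourier F R \<xi> - G \<xi>)"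
  from assms have L: "F \<in> L2 lborel" "G \<in> L2 lborel" "G' \<in> L2 lborel"
    and lim: "(?n G \<longlongrightarrow> 0) at_top" "(?n G' \<longlongrightarrow> 0) at_top"
    by (auto simp: has_fourier_transform_iff)
  have "L2_norm lborel (\<lambda>\<xi>. G \<xi> - G' \<xi>) \<le> ?n G R + ?n G' R" for R
    using L2_norm_diff_triangle[OF L(2) truncated_fourier_Plancherel(1)[OF L(1), of R] L(3)]
    unfolding L2_norm_minus_commute[of lborel G "truncated_fourier F R"] .
  moreover have "((\<lambda>R. ?n G R + ?n G' R) \<longlongrightarrow> 0) at_top" using lim by (rule tendsto_add_zero)
  ultimately have "L2_norm lborel (\<lambda>\<xi>. G \<xi> - G' \<xi>) \<le> 0"
    by (intro tendsto_lowerbound[where F=at_top]) (auto simp: always_eventually)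
  then have "L2_norm lborel (\<lambda>\<xi>. G \<xi> - G' \<xi>) = 0" by (simp add: order_antisym)
  from L2_norm_eq_0_AE[OF L2_diff[OF L(2,3)] this] show ?thesis by simp
qed

text \<open>Membership provides some transform with a finite weighted integral, whereas
  \<open>fourier\<close> chooses one arbitrarily. Uniqueness almost everywhere transfers the
  integrability to the chosen one.\<close>

lemma sobolev_fourier:
  assumes "F \<in> sobolev s"
  shows "has_fourier_transform F (fourier F)"
    and "integrable lborel (\<lambda>\<xi>. (1 + \<xi>\<^sup>2) powr s * (cmod (fourier F \<xi>))\<^sup>2)"
proof -
  from assms obtain G where G: "has_fourier_transform F G"
    "integrable lborel (\<lambda>\<xi>. (1 + \<xi>\<^sup>2) powr s * (cmod (G \<xi>))\<^sup>2)"
    by (auto simp: sobolev_def)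
  show h: "has_fourier_transform F (fourier F)"
    unfolding fourier_def by (rule someI[of _ G]) (rule G)
  then have [measurable]: "fourier F \<in> borel_measurable lborel"
    by (auto simp: has_fourier_transform_def L2_def)
  have "AE \<xi> in lborel. (1 + \<xi>\<^sup>2) powr s * (cmod (G \<xi>))\<^sup>2 = (1 + \<xi>\<^sup>2) powr s * (cmod (fourier F \<xi>))\<^sup>2"
    using has_fourier_transform_unique[OF G(1) h] by eventually_elim simp
  from integrable_cong_AE_imp[OF G(2) _ this]
  show "integrable lborel (\<lambda>\<xi>. (1 + \<xi>\<^sup>2) powr s * (cmod (fourier F \<xi>))\<^sup>2)" by simp
qed

section \<open>Functions on the interval and the sinc operator\<close>

lemma L2_inner_commute: "L2_inner M g f = cnj (L2_inner M f g)"
proof -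
  have "L2_inner M g f = (LINT x|M. cnj (f x * cnj (g x)))"
    unfolding L2_inner_def by (simp add: mult.commute)
  then show ?thesis unfolding L2_inner_def by (simp only: Bochner_Integration.integral_cnj)
qed

lemma L2_inner_self: "L2_inner M f f = of_real ((L2_norm M f)\<^sup>2)"
  unfolding L2_inner_def L2_norm_square
  by (simp add: complex_norm_square[symmetric] flip: integral_complex_of_real)

lemma L2_inner_diff_left:
  assumes "f \<in> L2 M" "g \<in> L2 M" "h \<in> L2 M"
  shows "L2_inner M (\<lambda>x. f x - g x) h = L2_inner M f h - L2_inner M g h"
  unfolding L2_inner_def using assms by (simp add: left_diff_distrib L2_mult_integrable)

lemma L2_inner_sum_left:
  assumes "\<And>n. n \<in> A \<Longrightarrow> e n \<in> L2 M" and "g \<in> L2 M"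
  shows "L2_inner M (\<lambda>x. \<Sum>n\<in>A. a n * e n x) g = (\<Sum>n\<in>A. a n * L2_inner M (e n) g)"
proof -
  have "L2_inner M (\<lambda>x. \<Sum>n\<in>A. a n * e n x) g = (LINT x|M. (\<Sum>n\<in>A. a n * (e n x * cnj (g x))))"
    unfolding L2_inner_def by (simp add: sum_distrib_right mult.assoc)
  also have "\<dots> = (\<Sum>n\<in>A. (LINT x|M. a n * (e n x * cnj (g x))))"
    using assms by (intro Bochner_Integration.integral_sum integrable_mult_right L2_mult_integrable)
  finally show ?thesis unfolding L2_inner_def by simp
qed

text \<open>The weights let one identity serve twice: with weight 1 for the eigenfunctions on the
  interval, and with weights \<open>2 * pi * \<mu> n\<close> for their transforms on the
  band.\<close>

lemma L2_norm_orthogonal_sum: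
  assumes A: "finite A" and e: "\<And>n. n \<in> A \<Longrightarrow> e n \<in> L2 M"
    and o: "\<And>m n. m \<in> A \<Longrightarrow> n \<in> A \<Longrightarrow> L2_inner M (e m) (e n) = (if m = n then of_real (w m) else 0)"
  shows "(L2_norm M (\<lambda>x. \<Sum>n\<in>A. a n * e n x))\<^sup>2 = (\<Sum>n\<in>A. w n * (cmod (a n))\<^sup>2)"
proof -
  let ?S = "\<lambda>x. \<Sum>n\<in>A. a n * e n x"
  have S: "?S \<in> L2 M" by (intro L2_sum L2_scale e)
  have "L2_inner M (e m) ?S = cnj (a m) * of_real (w m)" if m: "m \<in> A" for m
  proof -
    have "L2_inner M ?S (e m) = (\<Sum>n\<in>A. a n * (if n = m then of_real (w n) else 0))"
      unfolding L2_inner_sum_left[of A e M "e m" a, OF e e[OF m], simplified] by (intro sum.cong) (auto simp: o m)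
    also have "\<dots> = a m * of_real (w m)" using A m by (simp add: if_distrib sum.delta cong: if_cong)
    finally show ?thesis by (subst L2_inner_commute) simp
  qed
  then have "L2_inner M ?S ?S = (\<Sum>n\<in>A. a n * (cnj (a n) * of_real (w n)))"
    unfolding L2_inner_sum_left[of A e M ?S a, OF e S, simplified] by simp
  also have "\<dots> = of_real (\<Sum>n\<in>A. w n * (cmod (a n))\<^sup>2)"
    by (simp only: of_real_sum of_real_mult complex_norm_square mult_ac)
  finally show ?thesis unfolding L2_inner_self by (simp only: of_real_eq_iff)
qed

lemma zero_extension_eq: "zero_extension u x = indicator {-1..1} x *\<^sub>R u x"
  by (simp add: zero_extension_def indicator_def)

lemma zero_extension_diff:
  "zero_extension (\<lambda>x. f x - g x) x = zero_extension f x - zero_extension g x"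
  by (simp add: zero_extension_def)

lemma zero_extension_sum:
  "zero_extension (\<lambda>x. \<Sum>n\<in>A. a n * f n x) x = (\<Sum>n\<in>A. a n * zero_extension (f n) x)"
  by (cases "x \<in> {-1..1}") (auto simp: zero_extension_def)

lemma L2_norm_zero_extension: "L2_norm lborel (zero_extension u) = L2_norm leb_I u"
  unfolding L2_norm_def
  by (subst integral_restrict_space)
     (auto simp: zero_extension_def indicator_def intro!: arg_cong[where f=sqrt] Bochner_Integration.integral_cong)

text \<open>\<open>F\<close> may be any function on the line: only its values on the interval enter.
  This is what admits an arbitrary extension of \<open>f\<close> in the final estimate.\<close>

lemma L2_inner_zero_extension: "L2_inner lborel F (zero_extension v) = L2_inner leb_I F v"
  unfolding L2_inner_def
  by (subst integral_restrict_space)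
     (auto simp: zero_extension_def indicator_def intro!: Bochner_Integration.integral_cong)

lemma zero_extension_L2:
  assumes u: "u \<in> L2 leb_I" shows "zero_extension u \<in> L2 lborel"
proof (rule L2I)
  have I: "{-1..1::real} \<inter> space lborel \<in> sets lborel" by simp
  show "zero_extension u \<in> borel_measurable lborel"
    using L2_measurable[OF u] unfolding borel_measurable_restrict_space_iff[OF I] zero_extension_eq[abs_def] .
  have "integrable lborel (\<lambda>x. indicator {-1..1} x *\<^sub>R (cmod (u x))\<^sup>2)"
    using L2_integrable_square[OF u] unfolding integrable_restrict_space[OF I] .
  moreover have "(\<lambda>x. indicator {-1..1} x *\<^sub>R (cmod (u x))\<^sup>2) = (\<lambda>x. (cmod (zero_extension u x))\<^sup>2)"
    by (auto simp: zero_extension_def indicator_def)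
  ultimately show "integrable lborel (\<lambda>x. (cmod (zero_extension u x))\<^sup>2)" by simp
qed

lemma indicator_mult_zero_extension:
  "1 \<le> R \<Longrightarrow> (\<lambda>x. indicator {-R..R} x * zero_extension u x) = zero_extension u"
  by (auto simp: zero_extension_def indicator_def)

lemma integrable_zero_extension:
  "u \<in> L2 leb_I \<Longrightarrow> integrable lborel (zero_extension u)"
  using integrable_truncation[OF zero_extension_L2, of u 1] by (simp add: indicator_mult_zero_extension)

text \<open>An explicit integral, in contrast to the choice made by \<open>fourier\<close>, so that
  linearity on square-integrable functions on the interval holds at every point.\<close>

definition fourier_I :: "(real \<Rightarrow> complex) \<Rightarrow> real \<Rightarrow> complex" where
  "fourier_I u = fourier_integral (zero_extension u)"

lemma fourier_I_L2: "u \<in> L2 leb_I \<Longrightarrow> fourier_I u \<in> L2 lborel"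
  unfolding fourier_I_def
  by (intro fourier_integral_Plancherel zero_extension_L2 integrable_zero_extension)

lemma L2_norm_fourier_I:
  assumes "u \<in> L2 leb_I" shows "L2_norm lborel (fourier_I u) = sqrt (2 * pi) * L2_norm leb_I u"
proof -
  have "(L2_norm lborel (fourier_I u))\<^sup>2 = (sqrt (2 * pi) * L2_norm leb_I u)\<^sup>2"
    unfolding fourier_I_def power_mult_distrib
    using fourier_integral_Plancherel(2)[OF zero_extension_L2 integrable_zero_extension] assms
    by (simp add: L2_norm_zero_extension)
  then show ?thesis by (rule power2_eq_imp_eq) auto
qed

text \<open>Truncation to [-R, R] changes nothing once \<open>R \<ge> 1\<close>, so the truncated
  transforms are eventually equal to their limit.\<close>

lemma has_fourier_transform_zero_extension:
  assumes u: "u \<in> L2 leb_I"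
  shows "has_fourier_transform (zero_extension u) (fourier_I u)"
  unfolding has_fourier_transform_iff
proof (intro conjI zero_extension_L2 fourier_I_L2 u tendsto_eventually)
  show "\<forall>\<^sub>F R in at_top. L2_norm lborel (\<lambda>\<xi>. truncated_fourier (zero_extension u) R \<xi> - fourier_I u \<xi>) = 0"
    using eventually_ge_at_top[of "1::real"]
    by eventually_elim (simp add: truncated_fourier_eq indicator_mult_zero_extension fourier_I_def L2_norm_def)
qed

lemma fourier_I_diff:
  "f \<in> L2 leb_I \<Longrightarrow> g \<in> L2 leb_I \<Longrightarrow> fourier_I (\<lambda>x. f x - g x) \<xi> = fourier_I f \<xi> - fourier_I g \<xi>"
  unfolding fourier_I_def zero_extension_diff[abs_def]
  by (intro fourier_integral_diff integrable_zero_extension)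

lemma fourier_I_sum:
  assumes "\<And>n. n \<in> A \<Longrightarrow> f n \<in> L2 leb_I"
  shows "fourier_I (\<lambda>x. \<Sum>n\<in>A. a n * f n x) \<xi> = (\<Sum>n\<in>A. a n * fourier_I (f n) \<xi>)"
  unfolding fourier_I_def zero_extension_sum[abs_def]
  using assms by (simp add: fourier_integral_sum fourier_integral_scale integrable_zero_extension)

section \<open>The sinc operator as band limitation, and the spectral tail\<close>

lemma integral_cis_Icc:
  assumes a: "a \<noteq> 0" and c: "0 \<le> c"
  shows "(LINT x|lborel. indicator {-c..c} x *\<^sub>R cis (a * x)) = of_real (2 * sin (c * a) / a)"
proof -
  have "(LINT x|lborel. indicator {-c..c} x *\<^sub>R cis (a * x)) =
      cis (a * c) / (\<i> * a) - cis (a * (- c)) / (\<i> * a)"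
  proof (rule integral_FTC_atLeastAtMost)
    fix x
    have "((\<lambda>z. exp (\<i> * (of_real a * z)) / (\<i> * a)) has_field_derivative
        exp (\<i> * (of_real a * of_real x))) (at (of_real x))"
      using a by (auto intro!: derivative_eq_intros simp: field_simps)
    from has_vector_derivative_real_field[OF this, of "{-c..c}"]
    show "((\<lambda>x. cis (a * x) / (\<i> * a)) has_vector_derivative cis (a * x)) (at x within {-c..c})"
      by (simp add: cis_conv_exp)
  qed (use c in \<open>auto intro!: continuous_intros\<close>)
  also have "\<dots> = (cis (a * c) - cis (a * (- c))) / (\<i> * a)"
    by (rule diff_divide_distrib[symmetric])
  also have "cis (a * c) - cis (a * (- c)) = \<i> * of_real (2 * sin (c * a))"
    by (simp add: complex_eq_iff mult.commute)
  also have "\<i> * of_real (2 * sin (c * a)) / (\<i> * a) = of_real (2 * sin (c * a) / a)"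
    using a by simp
  finally show ?thesis .
qed

lemma integrable_indicator_mult_bounded:
  fixes f :: "real \<Rightarrow> complex"
  assumes "f \<in> borel_measurable lborel" and "\<And>x. cmod (f x) \<le> B"
  shows "integrable lborel (\<lambda>x. indicator {-c..c} x *\<^sub>R f x)"
proof (rule Bochner_Integration.integrable_bound)
  show "integrable lborel (\<lambda>x. indicator {-c..c} x *\<^sub>R B)"
    by (intro integrable_scaleR_left integrable_real_indicator) (auto simp: emeasure_lborel_Icc_eq)
  have "0 \<le> B" using assms(2)[of 0] norm_ge_zero order_trans by blast
  then show "AE x in lborel. norm (indicator {-c..c} x *\<^sub>R f x) \<le> norm (indicator {-c..c} x *\<^sub>R B)"
    using assms(2) by (auto simp: indicator_def)
qed (use assms in measurable)

text \<open>Limiting frequencies to [-c, c] and then restricting to the interval is the operator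
  with the sinc kernel. The multiplication formula is used twice: to identify the inverse transform
  of the band-limited \<open>fourier_I u\<close>, and to bring the transform of \<open>v\<close>
  back to the interval.\<close>

lemma band_inner_fourier_I:
  assumes u: "u \<in> L2 leb_I" and v: "v \<in> L2 leb_I" and c: "c > 0"
  shows "L2_inner (restrict_space lborel {-c..c}) (fourier_I u) (fourier_I v) =
    2 * pi * L2_inner leb_I (sinc_operator c u) v"
proof -
  let ?U = "zero_extension u" and ?V = "zero_extension v"
  let ?B = "\<lambda>w. LINT x|lborel. cmod (zero_extension w x)"
  note iU = integrable_zero_extension[OF u] and iV = integrable_zero_extension[OF v]
  have mU: "fourier_I u \<in> borel_measurable lborel" using fourier_I_L2[OF u] by (rule L2_measurable)
  have inner: "(LINT \<xi>|lborel. indicator {-c..c} \<xi> *\<^sub>R (cis (x * \<xi>) * fourier_I u \<xi>)) =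
      2 * pi * sinc_operator c u x" for x
  proof -
    let ?g = "\<lambda>\<xi>. indicator {-c..c} \<xi> *\<^sub>R cis (x * \<xi>)"
    have ig: "integrable lborel ?g"
      by (rule integrable_indicator_mult_bounded[where B=1]) auto
    have "(LINT \<xi>|lborel. indicator {-c..c} \<xi> *\<^sub>R (cis (x * \<xi>) * fourier_I u \<xi>)) =
        (LINT y|lborel. ?U y * fourier_integral ?g y)"
      using fourier_integral_multiplication[OF iU ig] by (simp add: fourier_I_def)
    also have "\<dots> = (LINT y|lborel. 2 * pi * (indicator {-1..1} y *\<^sub>R
        (of_real (sin (c * (x - y)) / (pi * (x - y))) * u y)))"
    proof (rule integral_cong_AE)
      show "AE y in lborel. ?U y * fourier_integral ?g y =
          2 * pi * (indicator {-1..1} y *\<^sub>R (of_real (sin (c * (x - y)) / (pi * (x - y))) * u y))"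
        \<comment> \<open>At \<open>y = x\<close> division by zero makes the kernel 0, while the
          transform of the band-limited exponential is 2c. The point is discarded as a null
          set.\<close>
        using AE_lborel_singleton[of x]
      proof eventually_elim
        fix y assume "y \<noteq> x"
        have "fourier_integral ?g y = (LINT \<xi>|lborel. indicator {-c..c} \<xi> *\<^sub>R cis ((x - y) * \<xi>))"
          unfolding fourier_integral_def
          by (intro Bochner_Integration.integral_cong) (auto simp: cis_mult algebra_simps)
        also have "\<dots> = of_real (2 * sin (c * (x - y)) / (x - y))"
          using c \<open>y \<noteq> x\<close> by (intro integral_cis_Icc) auto
        finally have g: "fourier_integral ?g y = 2 * pi * of_real (sin (c * (x - y)) / (pi * (x - y)))"
          using \<open>y \<noteq> x\<close> by simp
        show "?U y * fourier_integral ?g y =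
          2 * pi * (indicator {-1..1} y *\<^sub>R (of_real (sin (c * (x - y)) / (pi * (x - y))) * u y))"
          unfolding g zero_extension_eq by (simp add: scaleR_conv_of_real mult_ac)
      qed
      have [measurable]: "?U \<in> borel_measurable borel" using iU by auto
      have [measurable]: "fourier_integral ?g \<in> borel_measurable borel"
        using fourier_integral_measurable[of ?g] ig by auto
      show "(\<lambda>y. ?U y * fourier_integral ?g y) \<in> borel_measurable lborel" by measurable
      have eq: "2 * pi * (indicator {-1..1} y *\<^sub>R (of_real (sin (c * (x - y)) / (pi * (x - y))) * u y)) =
          2 * pi * (of_real (sin (c * (x - y)) / (pi * (x - y))) * ?U y)" for y
        by (simp add: zero_extension_def indicator_def)
      show "(\<lambda>y. 2 * pi * (indicator {-1..1} y *\<^sub>R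
          (of_real (sin (c * (x - y)) / (pi * (x - y))) * u y))) \<in> borel_measurable lborel"
        unfolding eq by measurable
    qed
    also have "\<dots> = 2 * pi * sinc_operator c u x"
      unfolding sinc_operator_def integral_mult_right_zero
      by (intro arg_cong[where f="(*) (complex_of_real (2 * pi))"] integral_restrict_space[symmetric]) simp
    finally show ?thesis .
  qed
  \<comment> \<open>The multiplication formula involves no conjugation, so the conjugate is absorbed
    into one factor. The identity is accordingly derived for the conjugated inner product and
    conjugated back at the end.\<close>
  let ?h = "\<lambda>\<xi>. indicator {-c..c} \<xi> *\<^sub>R cnj (fourier_I u \<xi>)"
  have ih: "integrable lborel ?h"
  proof (rule integrable_indicator_mult_bounded[where B="?B u"])
    show "cmod (cnj (fourier_I u x)) \<le> ?B u" for x
      unfolding fourier_I_def complex_mod_cnj by (rule norm_fourier_integral_le)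
  qed (use mU in measurable)
  have h: "fourier_integral ?h x = cnj (2 * pi * sinc_operator c u x)" for x
  proof -
    have "fourier_integral ?h x =
        (LINT \<xi>|lborel. cnj (indicator {-c..c} \<xi> *\<^sub>R (cis (x * \<xi>) * fourier_I u \<xi>)))"
      unfolding fourier_integral_def
      by (intro Bochner_Integration.integral_cong) (auto simp: cis_cnj mult_ac)
    also have "\<dots> = cnj (2 * pi * sinc_operator c u x)"
      by (simp only: Bochner_Integration.integral_cnj inner)
    finally show ?thesis .
  qed
  have "cnj (L2_inner (restrict_space lborel {-c..c}) (fourier_I u) (fourier_I v)) =
      L2_inner (restrict_space lborel {-c..c}) (fourier_I v) (fourier_I u)"
    by (subst L2_inner_commute) simp
  also have "\<dots> = (LINT \<xi>|lborel. ?h \<xi> * fourier_I v \<xi>)"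
    by (subst L2_inner_restrict_space) (simp_all add: mult_ac)
  also have "\<dots> = (LINT x|lborel. ?V x * cnj (2 * pi * sinc_operator c u x))"
    unfolding fourier_I_def[of v] fourier_integral_multiplication[OF iV ih] h ..
  also have "\<dots> = L2_inner lborel ?V (\<lambda>x. 2 * pi * sinc_operator c u x)"
    unfolding L2_inner_def ..
  also have "\<dots> = cnj (L2_inner lborel (\<lambda>x. 2 * pi * sinc_operator c u x) ?V)"
    by (rule L2_inner_commute)
  also have "L2_inner lborel (\<lambda>x. 2 * pi * sinc_operator c u x) ?V =
      2 * pi * L2_inner leb_I (sinc_operator c u) v"
    unfolding L2_inner_zero_extension unfolding L2_inner_def by (simp add: mult.assoc)
  finally show ?thesis by (simp only: complex_cnj_cancel_iff)
qed

text \<open>Double orthogonality: being eigenfunctions, the \<open>\<psi> n\<close> are orthogonal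
  on the interval and have transforms orthogonal on the band, with the eigenvalue as the fraction of
  energy retained there.\<close>

lemma pswf_band_inner:
  assumes P: "pswf_system c \<psi> \<mu>" and c: "c > 0"
  shows "L2_inner (restrict_space lborel {-c..c}) (fourier_I (\<psi> m)) (fourier_I (\<psi> n)) =
    (if m = n then of_real (2 * pi * \<mu> m) else 0)"
proof -
  have \<psi>: "\<psi> k \<in> L2 leb_I" for k using P by (auto simp: pswf_system_def orthonormal_basis_I_def)
  have o: "L2_inner leb_I (\<psi> m) (\<psi> n) = (if m = n then 1 else 0)"
    using P by (auto simp: pswf_system_def orthonormal_basis_I_def)
  note [measurable] = L2_measurable[OF \<psi>]
  have AE: "AE x in leb_I. sinc_operator c (\<psi> m) x = of_real (\<mu> m) * \<psi> m x"
    using P by (auto simp: pswf_system_def)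
  \<comment> \<open>The eigenvalue equation holds only almost everywhere, so replacing the integrand
    requires measurability of the left side, obtained as that of an integral depending on a
    parameter.\<close>
  have m: "sinc_operator c (\<psi> m) \<in> borel_measurable leb_I"
  proof -
    interpret sigma_finite_measure leb_I
      by (rule sigma_finite_measure_restrict_space) (auto intro: lborel.sigma_finite_measure_axioms)
    have "(\<lambda>y::real. y) \<in> borel_measurable leb_I" by (rule measurable_restrict_space1) simp
    note [measurable] = this
    show ?thesis unfolding sinc_operator_def[abs_def] by measurable
  qed
  have "L2_inner leb_I (sinc_operator c (\<psi> m)) (\<psi> n) = L2_inner leb_I (\<lambda>x. of_real (\<mu> m) * \<psi> m x) (\<psi> n)"
    unfolding L2_inner_def
  proof (rule integral_cong_AE)
    show "AE x in leb_I. sinc_operator c (\<psi> m) x * cnj (\<psi> n x) = of_real (\<mu> m) * \<psi> m x * cnj (\<psi> n x)"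
      using AE by eventually_elim simp
  qed (use m in measurable)
  also have "\<dots> = of_real (\<mu> m) * L2_inner leb_I (\<psi> m) (\<psi> n)"
    unfolding L2_inner_def by (simp add: mult.assoc)
  finally show ?thesis unfolding band_inner_fourier_I[OF \<psi> \<psi> c] o by simp
qed

lemma pswf_tail_band_norm:
  fixes N :: nat
  assumes P: "pswf_system c \<psi> \<mu>" and c: "c > 0" and f: "f \<in> L2 leb_I"
  defines "D \<equiv> \<lambda>x. f x - partial_expansion \<psi> N f x"
  shows "L2_norm (restrict_space lborel {-c..c}) (fourier_I D) \<le> sqrt (2 * pi * \<mu> N) * L2_norm leb_I D"
proof -
  let ?B = "restrict_space lborel {-c..c}"
  let ?a = "\<lambda>n. L2_inner leb_I f (\<psi> n)"
  have \<psi>: "\<psi> k \<in> L2 leb_I" for k using P by (auto simp: pswf_system_def orthonormal_basis_I_def)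
  have o: "L2_inner leb_I (\<psi> m) (\<psi> n) = (if m = n then of_real 1 else 0)" for m n
    using P by (auto simp: pswf_system_def orthonormal_basis_I_def)
  have S: "partial_expansion \<psi> M f \<in> L2 leb_I" for M
    unfolding partial_expansion_def[abs_def] by (intro L2_sum L2_scale \<psi>)
  have D: "D \<in> L2 leb_I" unfolding D_def by (intro L2_diff f S)
  have dec: "decseq \<mu>"
    using P by (intro decseq_SucI) (auto simp: pswf_system_def less_imp_le)
  have \<mu>: "\<mu> n > 0" for n using P by (auto simp: pswf_system_def)
  \<comment> \<open>Finite sections of the tail. For \<open>M \<ge> N\<close> the distance from
    \<open>T M\<close> to \<open>D\<close> is the error of the \<open>M\<close>-th partial sum,
    which tends to 0 by completeness.\<close>
  define T where "T M x = (\<Sum>n\<in>{N..<M}. ?a n * \<psi> n x)" for M x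
  have T: "T M \<in> L2 leb_I" for M
    unfolding T_def[abs_def] by (intro L2_sum L2_scale \<psi>)
  have band: "L2_norm ?B (fourier_I (T M)) \<le> sqrt (2 * pi * \<mu> N) * L2_norm leb_I (T M)" for M
  proof (rule power2_le_imp_le)
    have "(L2_norm ?B (fourier_I (T M)))\<^sup>2 = (L2_norm ?B (\<lambda>\<xi>. \<Sum>n\<in>{N..<M}. ?a n * fourier_I (\<psi> n) \<xi>))\<^sup>2"
      unfolding T_def[abs_def] fourier_I_sum[OF \<psi>, abs_def] ..
    also have "\<dots> = (\<Sum>n\<in>{N..<M}. 2 * pi * \<mu> n * (cmod (?a n))\<^sup>2)"
      by (intro L2_norm_orthogonal_sum L2_restrict_space fourier_I_L2 \<psi> pswf_band_inner[OF P c]) auto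
    \<comment> \<open>The partial sum uses the indices below \<open>N\<close>, so the tail starts at
      \<open>N\<close> exactly and the decreasing eigenvalues are bounded by
      \<open>\<mu> N\<close>.\<close>
    also have "\<dots> \<le> (\<Sum>n\<in>{N..<M}. 2 * pi * \<mu> N * (cmod (?a n))\<^sup>2)"
      by (intro sum_mono mult_right_mono mult_left_mono) (auto intro: decseqD[OF dec])
    also have "\<dots> = 2 * pi * \<mu> N * (\<Sum>n\<in>{N..<M}. 1 * (cmod (?a n))\<^sup>2)"
      by (simp add: sum_distrib_left)
    also have "(\<Sum>n\<in>{N..<M}. 1 * (cmod (?a n))\<^sup>2) = (L2_norm leb_I (T M))\<^sup>2"
      unfolding T_def[abs_def] by (intro L2_norm_orthogonal_sum[symmetric] \<psi> o) auto
    finally show "(L2_norm ?B (fourier_I (T M)))\<^sup>2 \<le> (sqrt (2 * pi * \<mu> N) * L2_norm leb_I (T M))\<^sup>2"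
      using \<mu>[of N] by (simp add: power_mult_distrib)
  qed (use \<mu>[of N] in simp)
  let ?r = "\<lambda>M. L2_norm leb_I (\<lambda>x. T M x - D x)"
  have r: "?r M = L2_norm leb_I (\<lambda>x. f x - partial_expansion \<psi> M f x)" if "M \<ge> N" for M
  proof -
    have "partial_expansion \<psi> M f x = partial_expansion \<psi> N f x + T M x" for x
      unfolding partial_expansion_def T_def
      using sum.atLeastLessThan_concat[of 0 N M "\<lambda>n. ?a n * \<psi> n x"] that
      by (simp add: atLeast0LessThan)
    then have "T M x - D x = partial_expansion \<psi> M f x - f x" for x by (simp add: D_def)
    then show ?thesis by (simp add: L2_norm_minus_commute[of _ f])
  qed
  have "(\<lambda>M. L2_norm leb_I (\<lambda>x. f x - partial_expansion \<psi> M f x)) \<longlonglongrightarrow> 0"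
    using P f by (auto simp: pswf_system_def orthonormal_basis_I_def)
  moreover have "\<forall>\<^sub>F M in sequentially. L2_norm leb_I (\<lambda>x. f x - partial_expansion \<psi> M f x) = ?r M"
    using eventually_ge_at_top[of N] by eventually_elim (simp add: r)
  ultimately have r0: "?r \<longlonglongrightarrow> 0" by (rule Lim_transform_eventually)
  \<comment> \<open>Restriction to the band decreases norms and the transform multiplies them by
    sqrt(2 pi), so the band estimate survives the limit in \<open>M\<close>.\<close>
  have le: "L2_norm ?B (fourier_I D) \<le> sqrt (2 * pi * \<mu> N) * L2_norm leb_I (T M) + sqrt (2 * pi) * ?r M" for M
  proof -
    have "L2_norm ?B (\<lambda>\<xi>. fourier_I (T M) \<xi> - fourier_I D \<xi>) = L2_norm ?B (fourier_I (\<lambda>x. T M x - D x))"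
      using fourier_I_diff[OF T D] by presburger
    also have "\<dots> \<le> L2_norm lborel (fourier_I (\<lambda>x. T M x - D x))"
      by (intro L2_restrict_space fourier_I_L2 L2_diff T D) auto
    also have "\<dots> = sqrt (2 * pi) * ?r M"
      by (intro L2_norm_fourier_I L2_diff T D)
    finally have "L2_norm ?B (\<lambda>\<xi>. fourier_I (T M) \<xi> - fourier_I D \<xi>) \<le> sqrt (2 * pi) * ?r M" .
    moreover have "\<bar>L2_norm ?B (fourier_I (T M)) - L2_norm ?B (fourier_I D)\<bar>
        \<le> L2_norm ?B (\<lambda>\<xi>. fourier_I (T M) \<xi> - fourier_I D \<xi>)"
      by (intro L2_norm_diff_le L2_restrict_space fourier_I_L2 T D) auto
    ultimately show ?thesis using band[of M] by linarith
  qed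
  have "(\<lambda>M. L2_norm leb_I (T M)) \<longlonglongrightarrow> L2_norm leb_I D"
    by (intro tendsto_L2_norm D r0) (simp add: T)
  then have "(\<lambda>M. sqrt (2 * pi * \<mu> N) * L2_norm leb_I (T M) + sqrt (2 * pi) * ?r M) \<longlonglongrightarrow>
      sqrt (2 * pi * \<mu> N) * L2_norm leb_I D + sqrt (2 * pi) * 0"
    by (intro tendsto_intros r0)
  from LIMSEQ_le_const[OF this] le show ?thesis by auto
qed

section \<open>The error estimate\<close>

lemma sobolev_high_frequency:
  assumes F: "F \<in> sobolev s" and s: "s > 0" and c: "c > 0"
  shows "L2_norm (restrict_space lborel (space lborel - {-c..c})) (fourier F) \<le>
    sqrt (2 * pi) * ((1 + c\<^sup>2) powr (- s / 2) * sobolev_norm s F)"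
proof (rule power2_le_imp_le)
  let ?G = "fourier F" and ?A = "space lborel - {-c..c}"
  have A: "?A \<in> sets lborel" by simp
  have "?G \<in> L2 lborel" using sobolev_fourier(1)[OF F] by (simp add: has_fourier_transform_def)
  note i = integrable_mult_indicator[OF A L2_integrable_square[OF this]]
  \<comment> \<open>Outside the band the Sobolev weight is at least its value at \<open>c\<close>,
    because \<open>s\<close> is positive; inside, the left side vanishes.\<close>
  have w: "indicator ?A \<xi> *\<^sub>R (cmod (?G \<xi>))\<^sup>2 \<le>
      (1 + c\<^sup>2) powr (- s) * ((1 + \<xi>\<^sup>2) powr s * (cmod (?G \<xi>))\<^sup>2)" for \<xi>
  proof (cases "\<xi> \<in> ?A")
    case True
    then have "c < \<bar>\<xi>\<bar>" by auto
    then have "c\<^sup>2 \<le> \<xi>\<^sup>2" using c by (simp add: abs_le_square_iff[symmetric])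
    then have "(1 + c\<^sup>2) powr s \<le> (1 + \<xi>\<^sup>2) powr s" using s by (intro powr_mono2) auto
    then have "(1 + c\<^sup>2) powr (- s) * (1 + c\<^sup>2) powr s \<le> (1 + c\<^sup>2) powr (- s) * (1 + \<xi>\<^sup>2) powr s"
      by (intro mult_left_mono) auto
    moreover have "(1 + c\<^sup>2) powr (- s) * (1 + c\<^sup>2) powr s = 1"
      by (simp add: powr_add[symmetric] add_pos_nonneg add_nonneg_eq_0_iff)
    ultimately have "1 * (cmod (?G \<xi>))\<^sup>2 \<le> (1 + c\<^sup>2) powr (- s) * (1 + \<xi>\<^sup>2) powr s * (cmod (?G \<xi>))\<^sup>2"
      by (intro mult_right_mono) auto
    then show ?thesis using True by (simp add: mult.assoc)
  next
    case False
    then show ?thesis by simp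
  qed
  have "(L2_norm (restrict_space lborel ?A) ?G)\<^sup>2 \<le>
      (LINT \<xi>|lborel. (1 + c\<^sup>2) powr (- s) * ((1 + \<xi>\<^sup>2) powr s * (cmod (?G \<xi>))\<^sup>2))"
    unfolding L2_norm_restrict_space_square[OF A]
    by (intro integral_mono i integrable_mult_right sobolev_fourier F w)
  also have "\<dots> = 2 * pi * ((1 + c\<^sup>2) powr (- s) * (sobolev_norm s F)\<^sup>2)"
    unfolding sobolev_norm_def by (simp add: zero_le_divide_iff)
  also have "(1 + c\<^sup>2) powr (- s) = ((1 + c\<^sup>2) powr (- s / 2))\<^sup>2"
    by (simp add: power2_eq_square powr_add[symmetric])
  finally show "(L2_norm (restrict_space lborel ?A) ?G)\<^sup>2 \<le>
      (sqrt (2 * pi) * ((1 + c\<^sup>2) powr (- s / 2) * sobolev_norm s F))\<^sup>2"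
    by (simp add: power_mult_distrib)
qed (simp add: sobolev_norm_def)

lemma sobolev_extension_error_bound:
  assumes s: "s > 0" and c: "c > 0" and P: "pswf_system c \<psi> \<mu>"
    and f: "f \<in> L2 leb_I" and F: "F \<in> sobolev s" and eq: "AE x in leb_I. F x = f x"
  shows "L2_norm leb_I (\<lambda>x. f x - partial_expansion \<psi> N f x) \<le>
    (1 + c\<^sup>2) powr (- s / 2) * sobolev_norm s F + sqrt (\<mu> N) * L2_norm lborel F"
proof -
  let ?B = "restrict_space lborel {-c..c}" and ?H = "restrict_space lborel (space lborel - {-c..c})"
  let ?G = "fourier F" and ?S = "partial_expansion \<psi> N f"
  define D where "D = (\<lambda>x. f x - ?S x)"
  let ?d = "L2_norm leb_I D"
  have \<psi>: "\<psi> k \<in> L2 leb_I" for k using P by (auto simp: pswf_system_def orthonormal_basis_I_def)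
  have o: "L2_inner leb_I (\<psi> m) (\<psi> n) = (if m = n then 1 else 0)" for m n
    using P by (auto simp: pswf_system_def orthonormal_basis_I_def)
  have S: "?S \<in> L2 leb_I"
    unfolding partial_expansion_def[abs_def] by (intro L2_sum L2_scale \<psi>)
  have D: "D \<in> L2 leb_I" unfolding D_def by (intro L2_diff f S)
  have ft: "has_fourier_transform F ?G" by (rule sobolev_fourier[OF F])
  then have FL: "F \<in> L2 lborel" and GL: "?G \<in> L2 lborel" by (auto simp: has_fourier_transform_def)
  have \<psi>D: "L2_inner leb_I (\<psi> n) D = 0" if "n < N" for n
  proof -
    have "L2_inner leb_I ?S (\<psi> n) = (\<Sum>k<N. L2_inner leb_I f (\<psi> k) * (if k = n then 1 else 0))"
      unfolding partial_expansion_def[abs_def]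
      by (subst L2_inner_sum_left) (auto simp: \<psi> o)
    also have "\<dots> = L2_inner leb_I f (\<psi> n)" using that by (simp add: if_distrib sum.delta cong: if_cong)
    finally have "L2_inner leb_I D (\<psi> n) = 0"
      unfolding D_def by (subst L2_inner_diff_left) (auto simp: f S \<psi>)
    then show ?thesis by (subst L2_inner_commute) simp
  qed
  have "L2_inner leb_I ?S D = 0"
    unfolding partial_expansion_def[abs_def]
    by (subst L2_inner_sum_left) (auto simp: \<psi> D \<psi>D)
  then have "L2_inner leb_I D D = L2_inner leb_I f D"
    using L2_inner_diff_left[OF f S D] by (simp add: D_def)
  then have "?d\<^sup>2 = Re (L2_inner leb_I f D)"
    unfolding L2_inner_self by (metis Re_complex_of_real)
  also have "L2_inner leb_I f D = L2_inner leb_I F D"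
    unfolding L2_inner_def
  proof (rule integral_cong_AE)
    show "AE x in leb_I. f x * cnj (D x) = F x * cnj (D x)" using eq by eventually_elim simp
    note [measurable] = L2_measurable[OF f] L2_measurable[OF D]
    have [measurable]: "F \<in> borel_measurable leb_I"
      by (rule measurable_restrict_space1) (rule L2_measurable[OF FL])
    show "(\<lambda>x. f x * cnj (D x)) \<in> borel_measurable leb_I" "(\<lambda>x. F x * cnj (D x)) \<in> borel_measurable leb_I"
      by measurable
  qed
  also have "\<dots> = L2_inner lborel F (zero_extension D)" by (rule L2_inner_zero_extension[symmetric])
  also have "2 * pi * Re \<dots> = Re (L2_inner lborel ?G (fourier_I D))"
    by (rule has_fourier_transform_Parseval[OF ft has_fourier_transform_zero_extension[OF D], symmetric])
  finally have "2 * pi * ?d\<^sup>2 = Re (L2_inner lborel ?G (fourier_I D))" by simp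
  also have "\<dots> \<le> cmod (L2_inner lborel ?G (fourier_I D))" by (rule complex_Re_le_cmod)
  also have "\<dots> \<le> cmod (L2_inner ?B ?G (fourier_I D)) + cmod (L2_inner ?H ?G (fourier_I D))"
    by (subst L2_inner_split[OF GL fourier_I_L2[OF D], of "{-c..c}"]) (auto intro: norm_triangle_ineq)
  also have "\<dots> \<le> L2_norm ?B ?G * L2_norm ?B (fourier_I D) + L2_norm ?H ?G * L2_norm ?H (fourier_I D)"
    by (intro add_mono L2_Cauchy_Schwarz L2_restrict_space GL fourier_I_L2 D) auto
  \<comment> \<open>On the band the gain comes from \<open>D\<close>, through the eigenvalue, and
    \<open>F\<close> is treated by Plancherel alone. Outside the band the roles are
    exchanged.\<close>
  also have "\<dots> \<le> (sqrt (2 * pi) * L2_norm lborel F) * (sqrt (2 * pi * \<mu> N) * ?d) +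
      (sqrt (2 * pi) * ((1 + c\<^sup>2) powr (- s / 2) * sobolev_norm s F)) * (sqrt (2 * pi) * ?d)"
  proof (intro add_mono mult_mono)
    have "L2_norm ?B ?G \<le> L2_norm lborel ?G" by (intro L2_restrict_space GL) auto
    also have "\<dots> = sqrt (2 * pi) * L2_norm lborel F"
      by (rule power2_eq_imp_eq) (auto simp: power_mult_distrib has_fourier_transform_Plancherel[OF ft])
    finally show "L2_norm ?B ?G \<le> sqrt (2 * pi) * L2_norm lborel F" .
    show "L2_norm ?B (fourier_I D) \<le> sqrt (2 * pi * \<mu> N) * ?d"
      unfolding D_def by (rule pswf_tail_band_norm[OF P c f])
    show "L2_norm ?H ?G \<le> sqrt (2 * pi) * ((1 + c\<^sup>2) powr (- s / 2) * sobolev_norm s F)"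
      by (rule sobolev_high_frequency[OF F s c])
    have "L2_norm ?H (fourier_I D) \<le> L2_norm lborel (fourier_I D)"
      by (intro L2_restrict_space fourier_I_L2 D) auto
    then show "L2_norm ?H (fourier_I D) \<le> sqrt (2 * pi) * ?d" by (simp add: L2_norm_fourier_I D)
  qed (auto simp: sobolev_norm_def)
  also have "\<dots> = (sqrt (2 * pi) * sqrt (2 * pi)) *
      (((1 + c\<^sup>2) powr (- s / 2) * sobolev_norm s F + sqrt (\<mu> N) * L2_norm lborel F) * ?d)"
    unfolding real_sqrt_mult[of "2 * pi" "\<mu> N"] by algebra
  finally have le: "?d * ?d \<le> ((1 + c\<^sup>2) powr (- s / 2) * sobolev_norm s F + sqrt (\<mu> N) * L2_norm lborel F) * ?d"
    by (simp add: power2_eq_square)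
  have \<mu>: "0 < \<mu> N" using P by (auto simp: pswf_system_def)
  show ?thesis
  \<comment> \<open>Cancelling one factor \<open>?d\<close> requires it to be positive; otherwise
    the claim is only that the right side is nonnegative.\<close>
  proof (cases "?d = 0")
    case True
    then show ?thesis using \<mu> by (simp add: D_def sobolev_norm_def)
  next
    case False
    then have "0 < ?d" by (simp add: order_less_le)
    from mult_right_le_imp_le[OF le this] show ?thesis by (simp add: D_def)
  qed
qed

text \<open>The quotient norm is an infimum of a nonempty set of nonnegative numbers, and a positive
  multiple of it bounds \<open>nrm\<close> from below. Nonnegativity is what allows the constant in
  front of \<open>nrm f\<close> to be enlarged.\<close>

lemma standard_sobolev_I_norm_nonneg:
  assumes "standard_sobolev_I_norm s nrm" and f: "f \<in> sobolev_I s"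
  shows "0 \<le> nrm f"
proof -
  let ?Q = "{sobolev_norm s F | F. F \<in> sobolev s \<and> (AE x in leb_I. F x = f x)}"
  have "?Q \<noteq> {}" using f by (auto simp: sobolev_I_def)
  then have "0 \<le> Inf ?Q" by (rule cInf_greatest) (auto simp: sobolev_norm_def)
  moreover obtain A where "A > 0" "A * sobolev_I_quotient_norm s f \<le> nrm f"
    using assms unfolding standard_sobolev_I_norm_def by blast
  ultimately show ?thesis
    unfolding sobolev_I_quotient_norm_def by (meson mult_nonneg_nonneg less_imp_le order_trans)
qed

theorem theorem1:
  fixes s :: real
    and nrm :: "(real \<Rightarrow> complex) \<Rightarrow> real"
    and E :: "(real \<Rightarrow> complex) \<Rightarrow> real \<Rightarrow> complex"
  assumes "s > 0"
    and "standard_sobolev_I_norm s nrm"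
    and "extension_operator s nrm E"
  shows "(\<exists>K>0. \<forall>c>0. \<forall>\<psi> \<mu>. pswf_system c \<psi> \<mu> \<longrightarrow>
            (\<forall>f \<in> sobolev_I s. \<forall>N\<ge>1.
               L2_norm leb_I (\<lambda>x. f x - partial_expansion \<psi> N f x)
                 \<le> K * (1 + c\<^sup>2) powr (- s / 2) * nrm f + K * sqrt (\<mu> N) * L2_norm leb_I f)) \<and>
         (\<forall>c>0. \<forall>\<psi> \<mu>. pswf_system c \<psi> \<mu> \<longrightarrow>
            (\<forall>f \<in> sobolev_I_0 s. \<forall>N\<ge>1.
               L2_norm leb_I (\<lambda>x. f x - partial_expansion \<psi> N f x)
                 \<le> (1 + c\<^sup>2) powr (- s / 2) * sobolev_norm s (zero_extension f)
                    + sqrt (\<mu> N) * L2_norm leb_I f))"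
proof (intro conjI allI impI ballI)
  obtain C where C: "\<And>f. f \<in> sobolev_I s \<Longrightarrow> L2_norm lborel (E f) \<le> C * L2_norm leb_I f"
      "\<And>f. f \<in> sobolev_I s \<Longrightarrow> sobolev_norm s (E f) \<le> C * nrm f"
    using assms(3) unfolding extension_operator_def by blast
  \<comment> \<open>Nothing forces \<open>C\<close> to be positive, hence the maximum with 1. The
    choice precedes \<open>c\<close>, the eigenfunctions, \<open>f\<close> and \<open>N\<close>, so
    it is uniform in all of them.\<close>
  define K where "K = max C 1"
  show "\<exists>K>0. \<forall>c>0. \<forall>\<psi> \<mu>. pswf_system c \<psi> \<mu> \<longrightarrow>
            (\<forall>f \<in> sobolev_I s. \<forall>N\<ge>1.
               L2_norm leb_I (\<lambda>x. f x - partial_expansion \<psi> N f x)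
                 \<le> K * (1 + c\<^sup>2) powr (- s / 2) * nrm f + K * sqrt (\<mu> N) * L2_norm leb_I f)"
  proof (intro exI[of _ K] conjI allI impI ballI)
    show "K > 0" by (simp add: K_def)
    fix c :: real and \<psi> \<mu> f and N :: nat
    assume c: "c > 0" and P: "pswf_system c \<psi> \<mu>" and f: "f \<in> sobolev_I s"
    have E: "E f \<in> sobolev s" "AE x in leb_I. E f x = f x"
      using assms(3) f by (auto simp: extension_operator_def)
    have "f \<in> L2 leb_I" using f by (simp add: sobolev_I_def)
    have \<mu>: "0 < \<mu> N" using P by (auto simp: pswf_system_def)
    have "C * nrm f \<le> K * nrm f" "C * L2_norm leb_I f \<le> K * L2_norm leb_I f"
      using standard_sobolev_I_norm_nonneg[OF assms(2) f] by (auto simp: K_def intro!: mult_right_mono)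
    then have "sobolev_norm s (E f) \<le> K * nrm f" "L2_norm lborel (E f) \<le> K * L2_norm leb_I f"
      using C[OF f] by auto
    then have "(1 + c\<^sup>2) powr (- s / 2) * sobolev_norm s (E f) + sqrt (\<mu> N) * L2_norm lborel (E f) \<le>
        (1 + c\<^sup>2) powr (- s / 2) * (K * nrm f) + sqrt (\<mu> N) * (K * L2_norm leb_I f)"
      using \<mu> by (intro add_mono mult_left_mono) auto
    with sobolev_extension_error_bound[OF assms(1) c P \<open>f \<in> L2 leb_I\<close> E, of N]
    show "L2_norm leb_I (\<lambda>x. f x - partial_expansion \<psi> N f x)
        \<le> K * (1 + c\<^sup>2) powr (- s / 2) * nrm f + K * sqrt (\<mu> N) * L2_norm leb_I f"
      by (simp add: mult_ac)
  qed
next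
  fix c :: real and \<psi> \<mu> f and N :: nat
  assume c: "c > 0" and P: "pswf_system c \<psi> \<mu>" and f: "f \<in> sobolev_I_0 s"
  then have f': "f \<in> L2 leb_I" "zero_extension f \<in> sobolev s"
    by (auto simp: sobolev_I_0_def sobolev_I_def)
  \<comment> \<open>The zero extension is itself an admissible extension in
    \<open>sobolev s\<close>, and its L2 norm on the line is that of \<open>f\<close> on the
    interval, so the constant stays 1.\<close>
  have "AE x in leb_I. zero_extension f x = f x"
    by (rule AE_I2) (auto simp: zero_extension_def space_restrict_space)
  from sobolev_extension_error_bound[OF assms(1) c P f' this, of N]
  show "L2_norm leb_I (\<lambda>x. f x - partial_expansion \<psi> N f x)
      \<le> (1 + c\<^sup>2) powr (- s / 2) * sobolev_norm s (zero_extension f) + sqrt (\<mu> N) * L2_norm leb_I f"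
    by (simp add: L2_norm_zero_extension)
qed

end
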